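(* Let $G$ be a finite group. Then: (a) $|\mathcal{CD}(G)| = |L(G)| - 1$ if and only if $G \cong \mathbb{Z}_p$ for some prime $p$ or $G \cong Q_8$; (b) $|\mathcal{CD}(G)| = |L(G)| - 2$ if and only if $G \cong \mathbb{Z}_{p^2}$ for some prime $p$.
   Context: For a finite group $G$, $L(G)$ denotes the set (lattice) of all subgroups of $G$. For a subgroup $H \leq G$, $C_G(H)$ denotes the centralizer of $H$ in $G$, and the Chermak-Delgado measure of $H$ is $m_G(H) = |H|\,|C_G(H)|$. Put $m^*(G) = \max\{m_G(H) \mid H \leq G\}$. The Chermak-Delgado lattice of $G$ is $\mathcal{CD}(G) = \{H \leq G \mid m_G(H) = m^*(G)\}$. $\mathbb{Z}_n$ denotes the cyclic group of order $n$, and $Q_8$ denotes the quaternion group of order $8$, i.e. $Q_8 = \langle a, b \mid a^2 = b^2,\ a^4 = 1,\ b^{-1}ab = a^{-1}\rangle$. *)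

theory Defs
  imports "HOL-Algebra.Algebra" "HOL-Computational_Algebra.Primes"
begin

section \<open>The Chermak-Delgado lattice\<close>

definition subgroup_lattice :: "('a, 'b) monoid_scheme \<Rightarrow> 'a set set" where
  "subgroup_lattice G = {H. subgroup H G}"

definition centralizer :: "('a, 'b) monoid_scheme \<Rightarrow> 'a set \<Rightarrow> 'a set" where
  "centralizer G H = {g \<in> carrier G. \<forall>h\<in>H. g \<otimes>\<^bsub>G\<^esub> h = h \<otimes>\<^bsub>G\<^esub> g}"

definition CD_measure :: "('a, 'b) monoid_scheme \<Rightarrow> 'a set \<Rightarrow> nat" where
  "CD_measure G H = card H * card (centralizer G H)"

definition max_CD_measure :: "('a, 'b) monoid_scheme \<Rightarrow> nat" where
  "max_CD_measure G = Max {CD_measure G H | H. subgroup H G}"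

definition CD_lattice :: "('a, 'b) monoid_scheme \<Rightarrow> 'a set set" where
  "CD_lattice G = {H. subgroup H G \<and> CD_measure G H = max_CD_measure G}"


section \<open>Groups given by generators and relations\<close>

text \<open>The generators are all elements of a type; a relation \<open>u = v\<close> is a pair of words.\<close>

datatype 'g letter = Gen 'g | Gen_inv 'g

inductive pres_eq :: "('g letter list \<times> 'g letter list) set \<Rightarrow> 'g letter list \<Rightarrow> 'g letter list \<Rightarrow> bool"
  for R where
  refl: "pres_eq R u u"
| sym: "pres_eq R u v \<Longrightarrow> pres_eq R v u"
| trans: "pres_eq R u v \<Longrightarrow> pres_eq R v w \<Longrightarrow> pres_eq R u w"
| append: "pres_eq R u u' \<Longrightarrow> pres_eq R v v' \<Longrightarrow> pres_eq R (u @ v) (u' @ v')"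
| right_inv: "pres_eq R [Gen x, Gen_inv x] []"
| left_inv: "pres_eq R [Gen_inv x, Gen x] []"
| relation: "(u, v) \<in> R \<Longrightarrow> pres_eq R u v"

definition pres_rel :: "('g letter list \<times> 'g letter list) set \<Rightarrow> ('g letter list \<times> 'g letter list) set" where
  "pres_rel R = {(u, v). pres_eq R u v}"

definition presented_group :: "('g letter list \<times> 'g letter list) set \<Rightarrow> 'g letter list set monoid" where
  "presented_group R =
     \<lparr>carrier = UNIV // pres_rel R,
      monoid.mult = (\<lambda>U V. \<Union>u\<in>U. \<Union>v\<in>V. pres_rel R `` {u @ v}),
      one = pres_rel R `` {[]}\<rparr>"

lemma equiv_pres_rel: "equiv UNIV (pres_rel R)"
  by (rule equivI)
     (auto simp: pres_rel_def refl_on_def sym_def trans_def intro: pres_eq.intros(1-3))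

lemma pres_class_eq_iff: "pres_rel R `` {u} = pres_rel R `` {v} \<longleftrightarrow> pres_eq R u v"
  using eq_equiv_class_iff[OF equiv_pres_rel, of u v R] by (simp add: pres_rel_def)

lemma carrier_presented_group: "carrier (presented_group R) = range (\<lambda>u. pres_rel R `` {u})"
  by (auto simp: presented_group_def quotient_def)

lemma one_presented_group: "\<one>\<^bsub>presented_group R\<^esub> = pres_rel R `` {[]}"
  by (simp add: presented_group_def)

lemma mult_presented_group:
  "(pres_rel R `` {u}) \<otimes>\<^bsub>presented_group R\<^esub> (pres_rel R `` {v}) = pres_rel R `` {u @ v}"
proof -
  have "pres_rel R `` {u' @ v'} = pres_rel R `` {u @ v}"
    if "u' \<in> pres_rel R `` {u}" "v' \<in> pres_rel R `` {v}" for u' v'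
    using that unfolding pres_class_eq_iff
    by (auto simp: pres_rel_def intro: pres_eq.append pres_eq.sym)
  moreover have "u \<in> pres_rel R `` {u}" "v \<in> pres_rel R `` {v}"
    by (auto simp: pres_rel_def intro: pres_eq.refl)
  ultimately have "(\<Union>u'\<in>pres_rel R `` {u}. \<Union>v'\<in>pres_rel R `` {v}. pres_rel R `` {u' @ v'})
      = pres_rel R `` {u @ v}"
    by (intro SUP_eq_const ballI) blast+
  then show ?thesis by (simp add: presented_group_def)
qed

lemma pres_eq_left_inverse: "\<exists>v. pres_eq R (v @ u) []"
proof (induction u)
  case Nil
  show ?case by (auto intro: pres_eq.refl exI[of _ "[]"])
next
  case (Cons l u)
  then obtain v where v: "pres_eq R (v @ u) []" by blast
  obtain l' where l': "pres_eq R [l', l] []"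
    by (cases l) (auto intro: pres_eq.left_inv pres_eq.right_inv)
  have "pres_eq R (v @ [l', l] @ u) (v @ [] @ u)"
    by (intro pres_eq.append pres_eq.refl l')
  then have "pres_eq R ((v @ [l']) @ l # u) []"
    using v by (auto intro: pres_eq.trans)
  then show ?case by blast
qed

lemma group_presented_group: "group (presented_group R)"
proof (rule groupI)
  fix x assume "x \<in> carrier (presented_group R)"
  then obtain u where u: "x = pres_rel R `` {u}" by (auto simp: carrier_presented_group)
  obtain v where "pres_eq R (v @ u) []" using pres_eq_left_inverse by blast
  then have "(pres_rel R `` {v}) \<otimes>\<^bsub>presented_group R\<^esub> x = \<one>\<^bsub>presented_group R\<^esub>"
    by (simp add: u mult_presented_group one_presented_group pres_class_eq_iff)
  then show "\<exists>y\<in>carrier (presented_group R). y \<otimes>\<^bsub>presented_group R\<^esub> x = \<one>\<^bsub>presented_group R\<^esub>"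
    by (auto simp: carrier_presented_group)
qed (auto simp: carrier_presented_group mult_presented_group one_presented_group)


section \<open>The quaternion group of order 8\<close>

datatype Q8_gen = a | b

definition Q8_relations :: "(Q8_gen letter list \<times> Q8_gen letter list) set" where
  "Q8_relations =
     {([Gen a, Gen a], [Gen b, Gen b]),
      ([Gen a, Gen a, Gen a, Gen a], []),
      ([Gen_inv b, Gen a, Gen b], [Gen_inv a])}"

definition Q8 :: "Q8_gen letter list set monoid" where
  "Q8 = presented_group Q8_relations"

lemma group_Q8: "group Q8"
  by (simp add: Q8_def group_presented_group)

text \<open>
  The presentation does define a group of order 8: letters act on the normal forms
  \<open>a^i b^j\<close> with \<open>i < 4\<close> and \<open>j < 2\<close>, encoded as pairs \<open>(i, j)\<close>, by left multiplication.
\<close>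

fun Q8_act :: "Q8_gen letter \<Rightarrow> nat \<times> bool \<Rightarrow> nat \<times> bool" where
  "Q8_act (Gen a) (i, j) = ((i + 1) mod 4, j)"
| "Q8_act (Gen_inv a) (i, j) = ((i + 3) mod 4, j)"
| "Q8_act (Gen b) (i, j) = (if j then ((3 * i + 2) mod 4, False) else ((3 * i) mod 4, True))"
| "Q8_act (Gen_inv b) (i, j) = (if j then ((3 * i) mod 4, False) else ((3 * i + 2) mod 4, True))"

definition Q8_nf :: "nat \<times> bool \<Rightarrow> Q8_gen letter list" where
  "Q8_nf s = replicate (fst s) (Gen a) @ (if snd s then [Gen b] else [])"

lemma Q8_nf_simps:
  "Q8_nf (0, j) = (if j then [Gen b] else [])"
  "Q8_nf (Suc 0, j) = Gen a # (if j then [Gen b] else [])"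
  "Q8_nf (2, j) = Gen a # Gen a # (if j then [Gen b] else [])"
  "Q8_nf (Suc (Suc 0), j) = Gen a # Gen a # (if j then [Gen b] else [])"
  "Q8_nf (3, j) = Gen a # Gen a # Gen a # (if j then [Gen b] else [])"
  by (simp_all add: Q8_nf_def numeral_eq_Suc)

lemma Q8_act_closed: "s \<in> {0..<4} \<times> UNIV \<Longrightarrow> foldr Q8_act w s \<in> {0..<4} \<times> UNIV"
proof (induction w)
  case (Cons l w)
  then show ?case
    by (cases "(l, foldr Q8_act w s)" rule: Q8_act.cases) auto
qed simp

lemma Q8_states: "s \<in> {0..<4} \<times> UNIV \<longleftrightarrow>
    s \<in> {(0::nat, False), (1, False), (2, False), (3, False), (0, True), (1, True), (2, True), (3, True)}"
  by (cases s) auto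

lemma Q8_act_cong:
  "pres_eq Q8_relations u v \<Longrightarrow> s \<in> {0..<4} \<times> UNIV \<Longrightarrow> foldr Q8_act u s = foldr Q8_act v s"
proof (induction arbitrary: s rule: pres_eq.induct)
  case (append u u' v v')
  then show ?case using Q8_act_closed[OF append.prems] by (metis foldr_append o_apply)
next
  case (right_inv x)
  then show ?case by (cases x) (auto simp: Q8_states)
next
  case (left_inv x)
  then show ?case by (cases x) (auto simp: Q8_states)
next
  case (relation u v)
  then show ?case by (auto simp: Q8_states Q8_relations_def)
qed auto

lemma Q8_act_nf:
  "s \<in> {0..<4} \<times> UNIV \<Longrightarrow> foldr Q8_act (Q8_nf s) (0, False) = s"
  by (auto simp: Q8_states Q8_nf_simps)

lemma Q8_nf_act:
  assumes "s \<in> {0..<4} \<times> UNIV"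
  shows "pres_eq Q8_relations (l # Q8_nf s) (Q8_nf (Q8_act l s))"
proof -
  let ?G = "presented_group Q8_relations"
  let ?c = "\<lambda>w. pres_rel Q8_relations `` {w}"
  interpret group ?G by (rule group_presented_group)
  define x y where "x = ?c [Gen a]" and "y = ?c [Gen b]"
  have xy [simp]: "x \<in> carrier ?G" "y \<in> carrier ?G"
    by (auto simp: x_def y_def carrier_presented_group)
  have c_nil: "?c [] = \<one>\<^bsub>?G\<^esub>" by (simp add: one_presented_group)
  have c_cons: "?c (l # w) = ?c [l] \<otimes>\<^bsub>?G\<^esub> ?c w" for l w
    by (simp add: mult_presented_group)
  have c_closed: "?c w \<in> carrier ?G" for w
    by (auto simp: carrier_presented_group)
  have inv: "?c [Gen_inv g] = inv\<^bsub>?G\<^esub> (?c [Gen g])" for g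
  proof (rule inv_equality[symmetric])
    show "?c [Gen_inv g] \<otimes>\<^bsub>?G\<^esub> ?c [Gen g] = \<one>\<^bsub>?G\<^esub>"
      by (simp add: mult_presented_group one_presented_group pres_class_eq_iff pres_eq.left_inv)
  qed (rule c_closed)+
  then have invs: "?c [Gen_inv a] = inv\<^bsub>?G\<^esub> x" "?c [Gen_inv b] = inv\<^bsub>?G\<^esub> y"
    by (simp_all only: x_def y_def)
  have rel: "?c u = ?c v" if "(u, v) \<in> Q8_relations" for u v
    using that by (simp add: pres_class_eq_iff pres_eq.relation)
  have r1: "?c [Gen a, Gen a] = ?c [Gen b, Gen b]"
   and r2: "?c [Gen a, Gen a, Gen a, Gen a] = ?c []"
   and r3: "?c [Gen_inv b, Gen a, Gen b] = ?c [Gen_inv a]"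
    by (rule rel; simp add: Q8_relations_def)+
  have yy: "y \<otimes>\<^bsub>?G\<^esub> y = x \<otimes>\<^bsub>?G\<^esub> x"
    using r1 by (simp add: x_def y_def mult_presented_group)
  have x4: "x \<otimes>\<^bsub>?G\<^esub> (x \<otimes>\<^bsub>?G\<^esub> (x \<otimes>\<^bsub>?G\<^esub> x)) = \<one>\<^bsub>?G\<^esub>"
    using r2 by (simp add: x_def mult_presented_group one_presented_group)
  have ix: "inv\<^bsub>?G\<^esub> x = x \<otimes>\<^bsub>?G\<^esub> (x \<otimes>\<^bsub>?G\<^esub> x)"
    using x4 by (intro inv_equality) (simp_all add: m_assoc)
  have "inv\<^bsub>?G\<^esub> y \<otimes>\<^bsub>?G\<^esub> (x \<otimes>\<^bsub>?G\<^esub> y) = inv\<^bsub>?G\<^esub> x"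
    using r3 unfolding invs[symmetric] by (simp add: x_def y_def mult_presented_group)
  then have xy_yx: "x \<otimes>\<^bsub>?G\<^esub> y = y \<otimes>\<^bsub>?G\<^esub> inv\<^bsub>?G\<^esub> x"
    by (metis inv_closed inv_solve_left m_closed xy)
  then have "x \<otimes>\<^bsub>?G\<^esub> y \<otimes>\<^bsub>?G\<^esub> x = y"
    by (simp add: m_assoc)
  then have "inv\<^bsub>?G\<^esub> x \<otimes>\<^bsub>?G\<^esub> y = y \<otimes>\<^bsub>?G\<^esub> x"
    by (metis inv_solve_left m_assoc m_closed xy)
  then have yx: "y \<otimes>\<^bsub>?G\<^esub> x = x \<otimes>\<^bsub>?G\<^esub> (x \<otimes>\<^bsub>?G\<^esub> (x \<otimes>\<^bsub>?G\<^esub> y))"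
    by (simp add: ix m_assoc)
  have yx': "y \<otimes>\<^bsub>?G\<^esub> (x \<otimes>\<^bsub>?G\<^esub> w) = x \<otimes>\<^bsub>?G\<^esub> (x \<otimes>\<^bsub>?G\<^esub> (x \<otimes>\<^bsub>?G\<^esub> (y \<otimes>\<^bsub>?G\<^esub> w)))"
    if "w \<in> carrier ?G" for w
    using that yx by (metis m_assoc m_closed xy)
  have x4': "x \<otimes>\<^bsub>?G\<^esub> (x \<otimes>\<^bsub>?G\<^esub> (x \<otimes>\<^bsub>?G\<^esub> (x \<otimes>\<^bsub>?G\<^esub> w))) = w" if "w \<in> carrier ?G" for w
    using that x4 by (metis m_assoc m_closed xy l_one)
  have iy: "inv\<^bsub>?G\<^esub> y = x \<otimes>\<^bsub>?G\<^esub> (x \<otimes>\<^bsub>?G\<^esub> y)"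
    by (intro inv_equality) (simp_all add: m_assoc yy x4)
  have yyw: "y \<otimes>\<^bsub>?G\<^esub> (y \<otimes>\<^bsub>?G\<^esub> w) = x \<otimes>\<^bsub>?G\<^esub> (x \<otimes>\<^bsub>?G\<^esub> w)" if "w \<in> carrier ?G" for w
    using that yy by (metis m_assoc xy)
  have ab: "?c [Gen a] = x" "?c [Gen b] = y" by (simp_all only: x_def y_def)
  define c where "c w = ?c w" for w
  have c0: "c [] = \<one>\<^bsub>?G\<^esub>" unfolding c_def by (rule c_nil)
  have c1: "c (l # w) = ?c [l] \<otimes>\<^bsub>?G\<^esub> c w" for l w unfolding c_def by (rule c_cons)
  have letter: "c [] = \<one>\<^bsub>?G\<^esub>"
      "c (Gen a # w) = x \<otimes>\<^bsub>?G\<^esub> c w" "c (Gen b # w) = y \<otimes>\<^bsub>?G\<^esub> c w"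
      "c (Gen_inv a # w) = inv\<^bsub>?G\<^esub> x \<otimes>\<^bsub>?G\<^esub> c w" "c (Gen_inv b # w) = inv\<^bsub>?G\<^esub> y \<otimes>\<^bsub>?G\<^esub> c w" for w
    by (simp_all only: c0 c1 ab invs)
  have l: "l \<in> {Gen a, Gen_inv a, Gen b, Gen_inv b}"
    by (metis (full_types) Q8_gen.exhaust insertCI letter.exhaust)
  have "c (l # Q8_nf s) = c (Q8_nf (Q8_act l s))"
    using l assms unfolding Q8_states
    by (elim insertE emptyE)
       (simp_all add: Q8_nf_simps letter ix iy m_assoc yx yx' x4 x4' yy yyw)
  then show ?thesis by (simp add: c_def pres_class_eq_iff)
qed

lemma Q8_nf_eq: "pres_eq Q8_relations w (Q8_nf (foldr Q8_act w (0, False)))"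
proof (induction w)
  case Nil
  show ?case by (simp add: Q8_nf_def pres_eq.refl)
next
  case (Cons l w)
  have "pres_eq Q8_relations ([l] @ w) ([l] @ Q8_nf (foldr Q8_act w (0, False)))"
    by (intro pres_eq.append pres_eq.refl Cons.IH)
  moreover have "pres_eq Q8_relations (l # Q8_nf (foldr Q8_act w (0, False)))
      (Q8_nf (Q8_act l (foldr Q8_act w (0, False))))"
    by (intro Q8_nf_act Q8_act_closed) auto
  ultimately show ?case by (auto intro: pres_eq.trans)
qed

lemma order_Q8: "order Q8 = 8"
proof -
  let ?c = "\<lambda>w. pres_rel Q8_relations `` {w}"
  let ?S = "{0..<4} \<times> UNIV :: (nat \<times> bool) set"
  have "inj_on (\<lambda>s. ?c (Q8_nf s)) ?S"
  proof (rule inj_onI)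
    fix s t assume st: "s \<in> ?S" "t \<in> ?S" and "?c (Q8_nf s) = ?c (Q8_nf t)"
    then have "pres_eq Q8_relations (Q8_nf s) (Q8_nf t)" by (simp add: pres_class_eq_iff)
    then have "foldr Q8_act (Q8_nf s) (0, False) = foldr Q8_act (Q8_nf t) (0, False)"
      by (rule Q8_act_cong) simp
    then show "s = t" using st by (simp only: Q8_act_nf)
  qed
  moreover have "(\<lambda>s. ?c (Q8_nf s)) ` ?S = carrier Q8"
  proof
    show "carrier Q8 \<subseteq> (\<lambda>s. ?c (Q8_nf s)) ` ?S"
    proof
      fix x assume "x \<in> carrier Q8"
      then obtain w where w: "x = ?c w" by (auto simp: Q8_def carrier_presented_group)
      have "x = ?c (Q8_nf (foldr Q8_act w (0, False)))"
        unfolding w pres_class_eq_iff by (rule Q8_nf_eq)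
      moreover have "foldr Q8_act w (0, False) \<in> ?S"
        by (rule Q8_act_closed) simp
      ultimately show "x \<in> (\<lambda>s. ?c (Q8_nf s)) ` ?S" by (rule image_eqI)
    qed
    show "(\<lambda>s. ?c (Q8_nf s)) ` ?S \<subseteq> carrier Q8"
      unfolding Q8_def carrier_presented_group by (intro image_subsetI rangeI)
  qed
  ultimately have "card (carrier Q8) = card ?S" by (metis card_image)
  then show ?thesis by (simp add: order_def card_cartesian_product)
qed

hide_const (open) a b

end

theory Submission
  imports Defs
begin

text \<open>
  Call a subgroup missing if it is not in \<open>CD(G)\<close>, and let \<open>Z\<close> be the center.
  Suppose that at most two subgroups are missing and that \<open>G \<noteq> 1\<close>.

  Suppose \<open>Z = 1\<close>. A subgroup of prime order that is the only one is central, so there are at least two,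
  \<open>P\<close> and \<open>Q\<close>. If 1 is missing, so is \<open>G\<close>, hence \<open>P\<close> and \<open>Q\<close>, and with them \<open>P \<inter> Q = 1\<close>, belong to \<open>CD(G)\<close>,
  a contradiction. Otherwise an orbit count shows that every subgroup of prime order is missing, so \<open>P\<close> and \<open>Q\<close>
  are the only ones. If their orders agree, they commute and their product contains a third one; if not, they
  are normal, and the centralizer of their join, which is in \<open>CD(G)\<close>, has index at least \<open>|P| |Q|\<close> by maximality but
  at most \<open>(|P| - 1) (|Q| - 1)\<close> by counting conjugates.

  If \<open>Z \<noteq> 1\<close>, then 1 is missing, at most one further subgroup \<open>K\<close> is missing, and \<open>K\<close> is normal. All
  members of \<open>CD(G)\<close> contain \<open>Z\<close> and any two of them permute. Let \<open>G\<close> be non-abelian and \<open>p\<close> a prime divisor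
  of \<open>|Z|\<close>. Each non-central element has a non-central power \<open>x\<close> for which the \<open>p\<close>-th power
  of \<open>x\<close> generates \<open>Z\<close>. Two such elements \<open>x\<close>, \<open>y\<close> that do not commute have a central commutator of order \<open>p\<close>,
  and the collection formula for \<open>(x\<^sup>k y)\<^sup>p\<close> forces \<open>p = |Z| = 2\<close>. Then \<open>\<langle>x\<rangle>\<langle>y\<rangle>\<close> is a quaternion group
  of order 8 in \<open>CD(G)\<close> whose centralizer is \<open>Z\<close>, so it is all of \<open>G\<close>.
  In the abelian case only \<open>G\<close> itself is not missing, and the subgroups are counted.
\<close>

section \<open>Counting in finite groups\<close>

text \<open>Serves twice: with multiplication on pairs in \<open>card_set_mult\<close>, and with
  conjugation of a fixed element in \<open>card_orbit_stabilizer\<close>.\<close>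

lemma card_eq_card_image_times_fibre:
  assumes "finite A" and "\<And>x. x \<in> A \<Longrightarrow> card {y \<in> A. f y = f x} = k"
  shows "card A = card (f ` A) * k"
proof -
  have "card A = (\<Sum>x\<in>A. 1)" by simp
  also have "\<dots> = (\<Sum>b\<in>f ` A. \<Sum>x\<in>{y \<in> A. f y = b}. 1)"
    using assms(1) by (rule sum.image_gen)
  also have "\<dots> = (\<Sum>b\<in>f ` A. k)"
    using assms(2) by (intro sum.cong) auto
  finally show ?thesis by simp
qed

locale finite_group = group G for G (structure) +
  assumes finite_carrier [simp]: "finite (carrier G)"
begin

section \<open>Orders of subgroups and of elements\<close>

lemma finite_subset_carrier: "A \<subseteq> carrier G \<Longrightarrow> finite A"
  using finite_carrier finite_subset by blast

lemma finite_subgroup: "subgroup H G \<Longrightarrow> finite H"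
  by (simp add: finite_subset_carrier subgroup.subset)

lemma card_subgroup_pos: "subgroup H G \<Longrightarrow> card H > 0"
  by (simp add: subgroup.finite_imp_card_positive)

lemma card_subgroup_dvd:
  assumes "subgroup H G" "subgroup K G" "H \<subseteq> K"
  shows "card H dvd card K"
proof -
  interpret K: group "G\<lparr>carrier := K\<rparr>" using assms(2) by (rule subgroup_imp_group)
  have "subgroup H (G\<lparr>carrier := K\<rparr>)" using assms by (rule subgroup_incl)
  from K.lagrange[OF this] have "card K = card (rcosets\<^bsub>G\<lparr>carrier := K\<rparr>\<^esub> H) * card H"
    by (simp add: order_def)
  then show ?thesis by simp
qed

lemma subgroup_eqI_card:
  assumes "subgroup K G" "H \<subseteq> K" "card K \<le> card H"
  shows "H = K"
  using assms by (intro card_seteq finite_subgroup)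

lemma ord_pos: "x \<in> carrier G \<Longrightarrow> ord x > 0"
  using ord_ge_1[OF finite_carrier] by fastforce

lemma generate_singleton: "x \<in> carrier G \<Longrightarrow> generate G {x} = range (\<lambda>k::nat. x [^] k)"
  using generate_pow_nat[of x] ord_pos[of x] by auto

lemma subgroup_generate_singleton: "x \<in> carrier G \<Longrightarrow> subgroup (generate G {x}) G"
  by (simp add: generate_is_subgroup)

lemma generate_singleton_subset: "subgroup H G \<Longrightarrow> x \<in> H \<Longrightarrow> generate G {x} \<subseteq> H"
  by (simp add: generate_subgroup_incl)

lemma mem_generate_singleton: "x \<in> generate G {x}"
  by (simp add: generate.incl)

lemma ord_dvd_card_subgroup: "subgroup H G \<Longrightarrow> x \<in> H \<Longrightarrow> ord x dvd card H"
  by (metis card_subgroup_dvd generate_pow_card generate_singleton_subset subgroup.mem_carrier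
      subgroup_generate_singleton)

lemma subgroup_pow_closed: "subgroup H G \<Longrightarrow> x \<in> H \<Longrightarrow> x [^] (k::nat) \<in> H"
  by (metis int_pow_int subgroup_int_pow_closed)

lemma generate_eq_prime_card_subgroup:
  assumes "subgroup P G" "Factorial_Ring.prime (card P)" "x \<in> P" "x \<noteq> \<one>"
  shows "generate G {x} = P" "ord x = card P"
proof -
  have x: "x \<in> carrier G" using assms by (meson subgroup.mem_carrier)
  have "ord x dvd card P" using assms by (intro ord_dvd_card_subgroup)
  moreover have "ord x \<noteq> 1" using x assms(4) ord_eq_1 by blast
  ultimately show *: "ord x = card P" using assms(2) by (metis prime_nat_iff)
  show "generate G {x} = P"
    using assms * x by (intro subgroup_eqI_card generate_singleton_subset) (auto simp: generate_pow_card)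
qed

lemma nontrivial_subgroupE:
  assumes "subgroup H G" "H \<noteq> {\<one>}"
  obtains x where "x \<in> H" "x \<noteq> \<one>"
  using assms subgroup.one_closed by blast

text \<open>Cauchy's theorem inside \<open>K\<close>: Sylow's theorem with exponent 1 gives a
  subgroup of order \<open>p\<close>, and each of its nontrivial elements has order
  \<open>p\<close>.\<close>

lemma prime_ord_exists:
  assumes "Factorial_Ring.prime p" "subgroup K G" "p dvd card K"
  obtains x where "x \<in> K" "ord x = p"
proof -
  interpret K: group "G\<lparr>carrier := K\<rparr>" using assms(2) by (rule subgroup_imp_group)
  obtain m where "card K = p ^ 1 * m" using assms(3) by (auto elim: dvdE)
  then obtain P where P: "subgroup P (G\<lparr>carrier := K\<rparr>)" "card P = p ^ 1"
    using sylow_thm[OF assms(1) K.is_group, of 1 m] finite_subgroup[OF assms(2)]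
    by (auto simp: order_def)
  have "subgroup P G" using P(1) assms(2) by (rule incl_subgroup[rotated])
  moreover have "P \<noteq> {\<one>}" using P(2) assms(1) by auto
  ultimately obtain x where "x \<in> P" "x \<noteq> \<one>" by (metis nontrivial_subgroupE)
  then have "ord x = p" using generate_eq_prime_card_subgroup \<open>subgroup P G\<close> P(2) assms(1) by simp
  moreover have "x \<in> K" using P(1) \<open>x \<in> P\<close> subgroup.subset by fastforce
  ultimately show thesis using that by blast
qed

text \<open>The fibre of multiplication through \<open>(h, k)\<close> consists of the pairs
  \<open>(h \<otimes> t, inv t \<otimes> k)\<close> with \<open>t\<close> in
  \<open>H \<inter> K\<close>, so all fibres have the size of the intersection.\<close>

lemma card_set_mult:
  assumes "subgroup H G" "subgroup K G"
  shows "card (H <#> K) * card (H \<inter> K) = card H * card K"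
proof -
  have HK: "\<And>h. h \<in> H \<Longrightarrow> h \<in> carrier G" "\<And>k. k \<in> K \<Longrightarrow> k \<in> carrier G"
    using assms[THEN subgroup.subset] by blast+
  let ?f = "\<lambda>(h, k). h \<otimes> k"
  have "card {u \<in> H \<times> K. ?f u = ?f v} = card (H \<inter> K)" if hk: "v \<in> H \<times> K" for v
  proof -
    obtain h k where v: "v = (h, k)" "h \<in> H" "k \<in> K" using hk by blast
    have "bij_betw (\<lambda>t. (h \<otimes> t, inv t \<otimes> k)) (H \<inter> K) {u \<in> H \<times> K. ?f u = ?f v}"
    proof (rule bij_betwI[where g = "\<lambda>u. inv h \<otimes> fst u"])
      have 1: "h \<otimes> t \<otimes> (inv t \<otimes> k) = h \<otimes> k" if "t \<in> H" for t
        using that v HK by (metis inv_closed l_one m_assoc m_closed r_inv)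
      show "(\<lambda>t. (h \<otimes> t, inv t \<otimes> k)) \<in> H \<inter> K \<rightarrow> {u \<in> H \<times> K. ?f u = ?f v}"
        using v assms 1 by (auto simp: subgroup.m_closed subgroup.m_inv_closed)
      show "(\<lambda>u. inv h \<otimes> fst u) \<in> {u \<in> H \<times> K. ?f u = ?f v} \<rightarrow> H \<inter> K"
      proof
        fix u assume "u \<in> {u \<in> H \<times> K. ?f u = ?f v}"
        then obtain h' k' where *: "u = (h', k')" "h' \<in> H" "k' \<in> K" "h' \<otimes> k' = h \<otimes> k"
          using v by auto
        then have "h' = h \<otimes> k \<otimes> inv k'"
          using v HK by (simp add: inv_solve_right)
        then have "inv h \<otimes> h' = k \<otimes> inv k'"
          using v *(2,3) HK by (simp add: inv_solve_left' m_assoc)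
        then show "inv h \<otimes> fst u \<in> H \<inter> K"
          using v * assms by (metis IntI fst_conv subgroup.m_closed subgroup.m_inv_closed)
      qed
      show "inv h \<otimes> fst (h \<otimes> t, inv t \<otimes> k) = t" if "t \<in> H \<inter> K" for t
        using that v HK by (simp flip: m_assoc)
      show "(h \<otimes> (inv h \<otimes> fst u), inv (inv h \<otimes> fst u) \<otimes> k) = u" if u: "u \<in> {u \<in> H \<times> K. ?f u = ?f v}" for u
      proof -
        obtain h' k' where *: "u = (h', k')" "h' \<in> H" "k' \<in> K" "h' \<otimes> k' = h \<otimes> k"
          using u v by auto
        have "h \<otimes> (inv h \<otimes> h') = h'" using * v HK by (simp flip: m_assoc)
        moreover have "inv (inv h \<otimes> h') \<otimes> k = k'"
          using * v HK by (simp add: inv_mult_group m_assoc inv_solve_left' flip: *(4))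
        ultimately show ?thesis using * by simp
      qed
    qed
    then show ?thesis by (rule bij_betw_same_card[symmetric])
  qed
  then have "card (H \<times> K) = card (?f ` (H \<times> K)) * card (H \<inter> K)"
    using assms finite_subgroup by (intro card_eq_card_image_times_fibre) auto
  moreover have "?f ` (H \<times> K) = H <#> K" by (auto simp: set_mult_def)
  ultimately show ?thesis by (simp add: card_cartesian_product)
qed

section \<open>Conjugation and orbits\<close>

definition conjugate :: "'a \<Rightarrow> 'a \<Rightarrow> 'a" where
  "conjugate g x = g \<otimes> x \<otimes> inv g"

lemma conjugate_closed [simp]: "g \<in> carrier G \<Longrightarrow> x \<in> carrier G \<Longrightarrow> conjugate g x \<in> carrier G"
  by (simp add: conjugate_def)

lemma conjugate_inv_cancel [simp]:
  "g \<in> carrier G \<Longrightarrow> x \<in> carrier G \<Longrightarrow> conjugate (inv g) (conjugate g x) = x"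
  "g \<in> carrier G \<Longrightarrow> x \<in> carrier G \<Longrightarrow> conjugate g (conjugate (inv g) x) = x"
  by (simp_all add: conjugate_def m_assoc) (simp_all add: flip: m_assoc)

lemma conjugate_mult: "g \<in> carrier G \<Longrightarrow> x \<in> carrier G \<Longrightarrow> y \<in> carrier G \<Longrightarrow>
    conjugate g (x \<otimes> y) = conjugate g x \<otimes> conjugate g y"
  by (simp add: conjugate_def m_assoc) (simp add: inv_solve_left flip: m_assoc)

lemma conjugate_hom: "g \<in> carrier G \<Longrightarrow> conjugate g \<in> hom G G"
  by (auto simp: hom_def conjugate_mult)

lemma conjugate_pow: "g \<in> carrier G \<Longrightarrow> x \<in> carrier G \<Longrightarrow> conjugate g (x [^] (n::nat)) = conjugate g x [^] n"
  by (metis conjugate_hom hom_nat_pow group_axioms)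

lemma conjugate_eq_self_iff: "g \<in> carrier G \<Longrightarrow> x \<in> carrier G \<Longrightarrow> conjugate g x = x \<longleftrightarrow> g \<otimes> x = x \<otimes> g"
  by (metis conjugate_def inv_solve_right m_closed)

lemma inj_on_conjugate: "g \<in> carrier G \<Longrightarrow> inj_on (conjugate g) (carrier G)"
  by (metis conjugate_inv_cancel(1) inj_onI)

lemma subgroup_conjugate: 
  assumes "g \<in> carrier G" "subgroup H G" shows "subgroup (conjugate g ` H) G"
proof -
  interpret group_hom G G "conjugate g"
    using assms(1) by unfold_locales (rule conjugate_hom) 
  show ?thesis using subgroup_img_is_subgroup assms(2) .
qed

lemma card_conjugate: "g \<in> carrier G \<Longrightarrow> H \<subseteq> carrier G \<Longrightarrow> card (conjugate g ` H) = card H"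
  by (meson card_image inj_on_conjugate inj_on_subset)

text \<open>Two elements of \<open>H\<close> conjugate \<open>x\<close> alike exactly when they lie
  in the same left coset of the stabilizer. The element \<open>x\<close> may lie outside
  \<open>H\<close>; later the centralizer of one subgroup acts on a generator of another.\<close>

lemma card_orbit_stabilizer:
  assumes H: "subgroup H G" and x: "x \<in> carrier G"
  shows "card H = card ((\<lambda>h. conjugate h x) ` H) * card {h \<in> H. h \<otimes> x = x \<otimes> h}"
proof (rule card_eq_card_image_times_fibre)
  show "finite H" using H by (rule finite_subgroup)
  fix h assume h: "h \<in> H"
  have Hc: "\<And>h. h \<in> H \<Longrightarrow> h \<in> carrier G" using subgroup.subset[OF H] by blast
  let ?S = "{h \<in> H. h \<otimes> x = x \<otimes> h}"
  have *: "conjugate h' x = conjugate h x \<longleftrightarrow> (inv h \<otimes> h') \<otimes> x = x \<otimes> (inv h \<otimes> h')"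
    if "h' \<in> carrier G" "h \<in> carrier G" for h h'
  proof -
    have "conjugate h' x = conjugate h x \<longleftrightarrow> h' \<otimes> x = h \<otimes> x \<otimes> inv h \<otimes> h'"
      using that x by (simp only: conjugate_def inv_solve_right' m_closed inv_closed)
    also have "\<dots> \<longleftrightarrow> inv h \<otimes> (h' \<otimes> x) = x \<otimes> inv h \<otimes> h'"
      using that x by (metis inv_solve_left m_closed inv_closed m_assoc)
    finally show ?thesis using that x by (simp add: m_assoc)
  qed
  have "bij_betw (\<lambda>s. h \<otimes> s) ?S {h' \<in> H. conjugate h' x = conjugate h x}"
  proof (rule bij_betwI[where g = "\<lambda>h'. inv h \<otimes> h'"])
    show "(\<lambda>s. h \<otimes> s) \<in> ?S \<rightarrow> {h' \<in> H. conjugate h' x = conjugate h x}"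
      using h H Hc by (auto simp: * subgroup.m_closed simp flip: m_assoc)
    show "(\<lambda>h'. inv h \<otimes> h') \<in> {h' \<in> H. conjugate h' x = conjugate h x} \<rightarrow> ?S"
      using h H Hc * by (auto simp: subgroup.m_closed subgroup.m_inv_closed)
  qed (use h Hc in \<open>simp_all add: flip: m_assoc\<close>)
  then show "card {h' \<in> H. conjugate h' x = conjugate h x} = card ?S"
    by (rule bij_betw_same_card[symmetric])
qed

end


section \<open>The lattice property\<close>

context finite_group begin

abbreviation "center \<equiv> centralizer G (carrier G)"

section \<open>Centralizers\<close>

lemma centralizer_subset: "centralizer G H \<subseteq> carrier G"
  by (auto simp: centralizer_def)

lemma subgroup_centralizer:
  assumes "H \<subseteq> carrier G" shows "subgroup (centralizer G H) G"
proof (rule subgroupI)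
  show "\<And>g. g \<in> centralizer G H \<Longrightarrow> inv g \<in> centralizer G H"
  proof -
    fix g assume g: "g \<in> centralizer G H"
    have "inv g \<otimes> h = h \<otimes> inv g" if "h \<in> H" for h
    proof -
      have "h \<in> carrier G" "g \<in> carrier G" "g \<otimes> h = h \<otimes> g" using that assms g by (auto simp: centralizer_def)
      then have "h = inv g \<otimes> (h \<otimes> g)" by (metis inv_solve_left m_closed)
      then show ?thesis using \<open>h \<in> carrier G\<close> \<open>g \<in> carrier G\<close>
        by (metis inv_closed inv_solve_right m_assoc m_closed)
    qed
    then show "inv g \<in> centralizer G H" using g by (auto simp: centralizer_def)
  qed
  show "\<And>g g'. g \<in> centralizer G H \<Longrightarrow> g' \<in> centralizer G H \<Longrightarrow> g \<otimes> g' \<in> centralizer G H"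
  proof -
    fix g g' assume g: "g \<in> centralizer G H" "g' \<in> centralizer G H"
    have "g \<otimes> g' \<otimes> h = h \<otimes> (g \<otimes> g')" if "h \<in> H" for h
    proof -
      have "h \<in> carrier G" "g \<in> carrier G" "g' \<in> carrier G" "g \<otimes> h = h \<otimes> g" "g' \<otimes> h = h \<otimes> g'"
        using that assms g by (auto simp: centralizer_def)
      then show ?thesis by (metis m_assoc)
    qed
    then show "g \<otimes> g' \<in> centralizer G H" using g by (auto simp: centralizer_def)
  qed
  have "\<one> \<in> centralizer G H" using assms by (auto simp: centralizer_def)
  then show "centralizer G H \<noteq> {}" by blast
qed (auto simp: centralizer_def)

lemma centralizer_antimono: "A \<subseteq> B \<Longrightarrow> centralizer G B \<subseteq> centralizer G A"
  by (auto simp: centralizer_def)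

lemma subset_centralizer_centralizer: "H \<subseteq> carrier G \<Longrightarrow> H \<subseteq> centralizer G (centralizer G H)"
  by (auto simp: centralizer_def)

text \<open>The double centralizer of \<open>H\<close> is a subgroup containing \<open>H\<close>,
  hence contains the generated subgroup. Taking centralizers reverses this, and the triple
  centralizer contains the single one.\<close>

lemma centralizer_generate:
  assumes "H \<subseteq> carrier G" shows "centralizer G (generate G H) = centralizer G H"
proof
  have "H \<subseteq> generate G H" by (auto intro: generate.incl)
  then show "centralizer G (generate G H) \<subseteq> centralizer G H" by (rule centralizer_antimono)
  have "generate G H \<subseteq> centralizer G (centralizer G H)"
    using assms by (intro generate_subgroup_incl subset_centralizer_centralizer subgroup_centralizer centralizer_subset)
  then have "centralizer G (centralizer G (centralizer G H)) \<subseteq> centralizer G (generate G H)"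
    by (rule centralizer_antimono)
  then show "centralizer G H \<subseteq> centralizer G (generate G H)"
    using subset_centralizer_centralizer[OF centralizer_subset] by blast
qed

lemma centralizer_Un: "centralizer G (A \<union> B) = centralizer G A \<inter> centralizer G B"
  by (auto simp: centralizer_def)

lemma mem_centralizer_generate_singleton_iff:
  assumes "x \<in> carrier G" 
  shows "g \<in> centralizer G (generate G {x}) \<longleftrightarrow> g \<in> carrier G \<and> g \<otimes> x = x \<otimes> g"
  using assms by (simp add: centralizer_generate) (simp add: centralizer_def)

lemma subgroup_center: "subgroup center G"
  by (simp add: subgroup_centralizer)

lemma center_subset_centralizer: "H \<subseteq> carrier G \<Longrightarrow> center \<subseteq> centralizer G H"
  by (rule centralizer_antimono)

lemma center_commute: "z \<in> center \<Longrightarrow> g \<in> carrier G \<Longrightarrow> z \<otimes> g = g \<otimes> z"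
  by (simp add: centralizer_def)

lemma centralizer_triv: "centralizer G {\<one>} = carrier G"
  by (auto simp: centralizer_def)

lemma centralizer_subset_center: "H \<subseteq> center \<Longrightarrow> centralizer G H = carrier G"
  by (auto simp: centralizer_def)

text \<open>Direct computation gives one inclusion; the same inclusion for \<open>inv g\<close> and
  the conjugated set gives the other.\<close>

lemma centralizer_conjugate:
  assumes g: "g \<in> carrier G" and H: "H \<subseteq> carrier G"
  shows "centralizer G (conjugate g ` H) = conjugate g ` centralizer G H"
proof -
  have *: "conjugate g ` centralizer G H \<subseteq> centralizer G (conjugate g ` H)" 
    if "g \<in> carrier G" "H \<subseteq> carrier G" for g H
  proof
    fix c assume "c \<in> conjugate g ` centralizer G H"
    then obtain d where d: "c = conjugate g d" "d \<in> carrier G" "\<And>h. h \<in> H \<Longrightarrow> d \<otimes> h = h \<otimes> d"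
      by (auto simp: centralizer_def)
    have "c \<otimes> conjugate g h = conjugate g h \<otimes> c" if "h \<in> H" for h
    proof -
      have "h \<in> carrier G" using that \<open>H \<subseteq> carrier G\<close> by blast
      then show ?thesis using d(1,2) d(3)[OF that] \<open>g \<in> carrier G\<close> by (metis conjugate_mult)
    qed
    then show "c \<in> centralizer G (conjugate g ` H)"
      using d that by (auto simp: centralizer_def)
  qed
  have "centralizer G (conjugate g ` H) = conjugate g ` conjugate (inv g) ` centralizer G (conjugate g ` H)"
  proof -
    have "conjugate g (conjugate (inv g) c) = c" if "c \<in> centralizer G (conjugate g ` H)" for c
      using that g by (simp add: centralizer_def)
    then show ?thesis by (simp add: image_image)
  qed
  also have "\<dots> \<subseteq> conjugate g ` centralizer G (conjugate (inv g) ` conjugate g ` H)"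
    using g H by (intro image_mono *) auto
  also have "conjugate (inv g) ` conjugate g ` H = H"
  proof -
    have "conjugate (inv g) (conjugate g h) = h" if "h \<in> H" for h
      using that g H by auto
    then show ?thesis by (simp add: image_image)
  qed
  finally show ?thesis using *[OF g H] by blast
qed

lemma subset_set_mult:
  assumes "subgroup A G" "subgroup B G"
  shows "A \<subseteq> A <#> B" "B \<subseteq> A <#> B"
  using assms[THEN subgroup.one_closed] assms[THEN subgroup.subset] unfolding set_mult_def
  by (force, force)

lemma centralizer_set_mult:
  assumes "subgroup A G" "subgroup B G"
  shows "centralizer G (A <#> B) = centralizer G A \<inter> centralizer G B"
proof
  show "centralizer G (A <#> B) \<subseteq> centralizer G A \<inter> centralizer G B"
    using centralizer_antimono subset_set_mult[OF assms] by blast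
  show "centralizer G A \<inter> centralizer G B \<subseteq> centralizer G (A <#> B)"
  proof
    fix c assume c: "c \<in> centralizer G A \<inter> centralizer G B"
    have "c \<otimes> (u \<otimes> v) = u \<otimes> v \<otimes> c" if "u \<in> A" "v \<in> B" for u v
    proof -
      have "c \<in> carrier G" "u \<in> carrier G" "v \<in> carrier G" "c \<otimes> u = u \<otimes> c" "c \<otimes> v = v \<otimes> c"
        using that c assms[THEN subgroup.subset] by (auto simp: centralizer_def)
      then show ?thesis by (metis m_assoc)
    qed
    then show "c \<in> centralizer G (A <#> B)" using c by (auto simp: centralizer_def set_mult_def)
  qed
qed

section \<open>Subgroups of maximal measure\<close>

lemma finite_subgroup_lattice: "finite (subgroup_lattice G)"
proof (rule finite_subset)
  show "subgroup_lattice G \<subseteq> Pow (carrier G)" 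
    by (auto simp: subgroup_lattice_def dest: subgroup.subset)
qed simp

lemma CD_measure_le_max: "subgroup H G \<Longrightarrow> CD_measure G H \<le> max_CD_measure G"
  unfolding max_CD_measure_def using finite_subgroup_lattice
  by (intro Max_ge) (auto simp: subgroup_lattice_def setcompr_eq_image)

lemma max_CD_measure_attained: "\<exists>H. subgroup H G \<and> CD_measure G H = max_CD_measure G"
proof -
  have "max_CD_measure G \<in> {CD_measure G H | H. subgroup H G}"
    unfolding max_CD_measure_def using finite_subgroup_lattice subgroup_self
    by (intro Max_in) (auto simp: subgroup_lattice_def setcompr_eq_image)
  then show ?thesis by auto
qed

lemma mem_CD_lattice_iff: "H \<in> CD_lattice G \<longleftrightarrow> subgroup H G \<and> max_CD_measure G \<le> CD_measure G H"
  using CD_measure_le_max by (auto simp: CD_lattice_def le_antisym)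

lemma CD_lattice_imp_subgroup: "H \<in> CD_lattice G \<Longrightarrow> subgroup H G"
  by (simp add: CD_lattice_def)

lemma CD_measure_CD_lattice: "H \<in> CD_lattice G \<Longrightarrow> card H * card (centralizer G H) = max_CD_measure G"
  by (simp add: CD_lattice_def CD_measure_def)

lemma CD_measure_triv: "CD_measure G {\<one>} = card (carrier G)"
  by (simp add: CD_measure_def centralizer_triv)

lemma max_CD_measure_pos: "max_CD_measure G > 0"
proof -
  have "0 < CD_measure G {\<one>}" using card_subgroup_pos subgroup_self by (simp add: CD_measure_triv)
  then show ?thesis using CD_measure_le_max triv_subgroup by (metis order_less_le_trans)
qed

text \<open>As \<open>H\<close> lies in its double centralizer, passing to the centralizer cannot
  decrease the measure. Maximality of \<open>H\<close> turns this into an equality, which forces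
  \<open>H\<close> and its double centralizer to have the same order.\<close>

lemma CD_lattice_centralizer:
  assumes "H \<in> CD_lattice G"
  shows "centralizer G H \<in> CD_lattice G" and "centralizer G (centralizer G H) = H"
proof -
  have H: "subgroup H G" "H \<subseteq> carrier G" using assms CD_lattice_imp_subgroup subgroup.subset by blast+
  have C: "subgroup (centralizer G H) G" "subgroup (centralizer G (centralizer G H)) G"
    using H by (simp_all add: subgroup_centralizer centralizer_subset)
  have sub: "H \<subseteq> centralizer G (centralizer G H)" using H(2) by (rule subset_centralizer_centralizer)
  then have "card H \<le> card (centralizer G (centralizer G H))"
    using C(2) by (intro card_mono finite_subgroup)
  then have "max_CD_measure G \<le> CD_measure G (centralizer G H)"
    unfolding CD_measure_CD_lattice[OF assms, symmetric] CD_measure_def by (simp add: mult.commute)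
  then show *: "centralizer G H \<in> CD_lattice G" using C(1) by (simp add: mem_CD_lattice_iff)
  have "card H * card (centralizer G H) = card (centralizer G (centralizer G H)) * card (centralizer G H)"
    using CD_measure_CD_lattice[OF assms] CD_measure_CD_lattice[OF *] by (simp add: mult.commute)
  then have "card H = card (centralizer G (centralizer G H))"
    using card_subgroup_pos[OF C(1)] by simp
  then show "centralizer G (centralizer G H) = H"
    using subgroup_eqI_card[OF C(2) sub] by simp
qed

text \<open>Members of the lattice are centralizers, namely of their own centralizers, and every
  centralizer contains the center.\<close>

lemma center_subset_CD_lattice: "H \<in> CD_lattice G \<Longrightarrow> center \<subseteq> H"
  using CD_lattice_centralizer(2) center_subset_centralizer[OF centralizer_subset] by blast

lemma CD_lattice_conjugate:
  assumes "g \<in> carrier G" "H \<in> CD_lattice G"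
  shows "conjugate g ` H \<in> CD_lattice G"
proof -
  have "subgroup H G" using assms(2) by (rule CD_lattice_imp_subgroup)
  then have "CD_measure G (conjugate g ` H) = CD_measure G H"
    using assms(1) by (simp add: CD_measure_def centralizer_conjugate card_conjugate centralizer_subset subgroup.subset)
  then show ?thesis using assms subgroup_conjugate by (simp add: CD_lattice_def)
qed

text \<open>The inequality m(A) m(B) \<le> m(A \<inter> B) m(\<langle>A, B\<rangle>) for the measure m follows by applying the product formula
  to A, B and to their centralizers; if A and B are maximal, all estimates used are equalities.\<close>

lemma CD_lattice_set_mult:
  assumes A: "A \<in> CD_lattice G" and B: "B \<in> CD_lattice G"
  shows "subgroup (A <#> B) G" "A <#> B \<in> CD_lattice G" "A \<inter> B \<in> CD_lattice G"
proof -
  let ?m = "max_CD_measure G" and ?C = "centralizer G"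
  have sA: "subgroup A G" "A \<subseteq> carrier G" and sB: "subgroup B G" "B \<subseteq> carrier G"
    using assms CD_lattice_imp_subgroup subgroup.subset by blast+
  define J where "J = generate G (A \<union> B)"
  have sJ: "subgroup J G" unfolding J_def using sA sB by (intro generate_is_subgroup) auto
  have AJ: "A \<subseteq> J" "B \<subseteq> J" by (auto simp: J_def intro: generate.incl)
  have CJ: "?C J = ?C A \<inter> ?C B"
    unfolding J_def using sA sB by (simp add: centralizer_generate centralizer_Un)
  have sI: "subgroup (A \<inter> B) G" using sA sB subgroups_Inter_pair by blast
  have sub1: "A <#> B \<subseteq> J"
    using AJ sJ by (auto simp: set_mult_def subgroup.m_closed subset_iff)
  have sCI: "subgroup (?C (A \<inter> B)) G" using sA by (intro subgroup_centralizer) auto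
  have "?C A \<subseteq> ?C (A \<inter> B)" "?C B \<subseteq> ?C (A \<inter> B)" by (intro centralizer_antimono; blast)+
  then have sub2: "?C A <#> ?C B \<subseteq> ?C (A \<inter> B)"
    using sCI by (auto simp: set_mult_def subgroup.m_closed subset_iff)
  define ab where "ab = card (A <#> B)"
  define cc where "cc = card (?C A <#> ?C B)"
  have le: "ab \<le> card J" "cc \<le> card (?C (A \<inter> B))"
    unfolding ab_def cc_def using sub1 sub2 sJ sCI by (simp_all add: card_mono finite_subgroup)
  \<comment> \<open>The product formula for \<open>A\<close>, \<open>B\<close> and for their
    centralizers regroups the product of the two measures into a factor bounded by the measure of
    the join \<open>J\<close> and one bounded by that of \<open>A \<inter> B\<close>.\<close>
  have "?m * ?m = (card A * card (?C A)) * (card B * card (?C B))"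
    using assms by (simp add: CD_measure_CD_lattice)
  also have "\<dots> = (card A * card B) * (card (?C A) * card (?C B))" by (simp add: ac_simps)
  also have "card A * card B = ab * card (A \<inter> B)"
    unfolding ab_def using sA sB by (simp add: card_set_mult)
  also have "card (?C A) * card (?C B) = cc * card (?C J)"
    unfolding cc_def CJ using sA sB by (simp add: card_set_mult subgroup_centralizer)
  finally have eq: "?m * ?m = (ab * card (?C J)) * (card (A \<inter> B) * cc)" by (simp add: ac_simps)
  have 1: "ab * card (?C J) \<le> CD_measure G J" "card (A \<inter> B) * cc \<le> CD_measure G (A \<inter> B)"
    using le by (simp_all add: CD_measure_def)
  have 2: "CD_measure G J \<le> ?m" "CD_measure G (A \<inter> B) \<le> ?m"
    using sJ sI by (simp_all add: CD_measure_le_max)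
  have "ab * card (?C J) = ?m \<and> card (A \<inter> B) * cc = ?m"
  proof -
    \<comment> \<open>Two factors that are at most \<open>m\<close> and have product
      \<open>m * m\<close> with \<open>m\<close> positive are both equal to
      \<open>m\<close>.\<close>
    have x: "x = m \<and> y = m" if "m * m = x * y" "x \<le> m" "y \<le> m" "0 < m" for x y m :: nat
    proof -
      have "x * y \<le> x * m" "x * y \<le> m * y" using that by simp_all
      then have "m \<le> x" "m \<le> y" using that(1,4) by (metis mult_le_cancel2 mult_le_cancel1)+
      then show ?thesis using that by simp
    qed
    show ?thesis using 1 2 max_CD_measure_pos by (intro x[OF eq]) auto
  qed
  then have J: "J \<in> CD_lattice G" and I: "A \<inter> B \<in> CD_lattice G" and abm: "ab * card (?C J) = ?m"
    using 1 sJ sI by (auto simp: mem_CD_lattice_iff)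
  have "card (?C J) > 0" using abm max_CD_measure_pos by (metis mult_0_right neq0_conv)
  \<comment> \<open>Equal orders make the product set itself the join, so it is a subgroup.\<close>
  then have "ab = card J" using CD_measure_CD_lattice[OF J] abm by (metis mult_right_cancel neq0_conv)
  then have "A <#> B = J" unfolding ab_def using sub1 sJ by (intro subgroup_eqI_card) auto
  then show "subgroup (A <#> B) G" "A <#> B \<in> CD_lattice G" "A \<inter> B \<in> CD_lattice G"
    using J I sJ by simp_all
qed

lemma carrier_in_CD_lattice_if_triv:
  assumes "{\<one>} \<in> CD_lattice G" 
  shows "carrier G \<in> CD_lattice G" "max_CD_measure G = card (carrier G)"
  using CD_lattice_centralizer(1)[OF assms] assms CD_measure_triv 
  by (auto simp: centralizer_triv CD_lattice_def)

end


section \<open>Groups with trivial center\<close>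

context finite_group begin

text \<open>A nontrivial common element would generate both subgroups.\<close>

lemma prime_card_subgroups_Int:
  assumes P: "subgroup P G" "Factorial_Ring.prime (card P)"
    and Q: "subgroup Q G" "Factorial_Ring.prime (card Q)" and "P \<noteq> Q"
  shows "P \<inter> Q = {\<one>}"
proof (rule ccontr)
  have I: "subgroup (P \<inter> Q) G" using P Q subgroups_Inter_pair by blast
  assume "P \<inter> Q \<noteq> {\<one>}"
  then obtain x where "x \<in> P" "x \<in> Q" "x \<noteq> \<one>" using nontrivial_subgroupE[OF I] by blast
  then have "P = Q" using P Q generate_eq_prime_card_subgroup(1) by metis
  then show False using \<open>P \<noteq> Q\<close> by simp
qed

lemma conjugate_eq_one_iff: "g \<in> carrier G \<Longrightarrow> x \<in> carrier G \<Longrightarrow> conjugate g x = \<one> \<longleftrightarrow> x = \<one>"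
  by (metis conjugate_def conjugate_inv_cancel(1) inv_closed one_closed r_inv r_one)

lemma conjugate_image_self:
  assumes "subgroup P G" "x \<in> P" shows "conjugate x ` P = P"
proof (rule subgroup_eqI_card)
  show "conjugate x ` P \<subseteq> P"
    using assms by (auto simp: conjugate_def subgroup.m_closed subgroup.m_inv_closed)
  show "card P \<le> card (conjugate x ` P)"
    using assms by (simp add: card_conjugate subgroup.subset subgroup.mem_carrier)
qed fact

text \<open>The identity is not a conjugate of \<open>x\<close>, so the class of \<open>x\<close>
  has at most \<open>card P - 1\<close> elements; its size is the index of the centralizer of
  \<open>x\<close>.\<close>

lemma card_le_if_orbit_subset:
  assumes P: "subgroup P G" and x: "x \<in> P" "x \<noteq> \<one>"
    and orbit: "\<And>g. g \<in> carrier G \<Longrightarrow> conjugate g x \<in> P"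
  shows "card ((\<lambda>g. conjugate g x) ` carrier G) \<le> card P - 1"
    and "card (carrier G) \<le> (card P - 1) * card (centralizer G (generate G {x}))"
proof -
  have xc: "x \<in> carrier G" by (rule subgroup.mem_carrier[OF P x(1)])
  let ?X = "(\<lambda>g. conjugate g x) ` carrier G"
  have "?X \<subseteq> P - {\<one>}" using orbit x xc by (auto simp: conjugate_eq_one_iff)
  then have "card ?X \<le> card (P - {\<one>})" using P by (intro card_mono) (auto simp: finite_subgroup)
  also have "\<dots> = card P - 1" using P by (simp add: subgroup.one_closed)
  finally show *: "card ?X \<le> card P - 1" .
  have "centralizer G (generate G {x}) = {g \<in> carrier G. g \<otimes> x = x \<otimes> g}"
    using xc by (auto simp: mem_centralizer_generate_singleton_iff)
  then show "card (carrier G) \<le> (card P - 1) * card (centralizer G (generate G {x}))"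
    using card_orbit_stabilizer[OF subgroup_self xc] * by simp
qed

text \<open>If \<open>P = \<langle>x\<rangle>\<close> of order \<open>p\<close> and 1 were both in \<open>CD(G)\<close>, the conjugacy class of \<open>x\<close> would have \<open>p\<close> elements,
  hence contain some \<open>y \<notin> P\<close>; but the centralizer of \<open>x\<close> already moves \<open>y\<close> to \<open>p\<close> elements distinct from \<open>x\<close>.\<close>

lemma prime_card_not_in_CD_lattice:
  assumes triv: "{\<one>} \<in> CD_lattice G" and P: "subgroup P G" "Factorial_Ring.prime (card P)"
  shows "P \<notin> CD_lattice G"
proof
  assume PCD: "P \<in> CD_lattice G"
  let ?n = "card (carrier G)" and ?p = "card P"
  have n: "max_CD_measure G = ?n" by (rule carrier_in_CD_lattice_if_triv[OF triv])
  have "P \<noteq> {\<one>}" using P(2) by auto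
  then obtain x where x: "x \<in> P" "x \<noteq> \<one>" using P(1) by (metis nontrivial_subgroupE)
  have xc: "x \<in> carrier G" by (rule subgroup.mem_carrier[OF P(1) x(1)])
  have gx: "generate G {x} = P" using P x by (intro generate_eq_prime_card_subgroup)
  let ?X = "(\<lambda>g. conjugate g x) ` carrier G"
  have C: "centralizer G P = {g \<in> carrier G. g \<otimes> x = x \<otimes> g}"
    using xc by (auto simp: mem_centralizer_generate_singleton_iff simp flip: gx)
  have sC: "subgroup (centralizer G P) G" using P by (simp add: subgroup_centralizer subgroup.subset)
  have pC: "?p * card (centralizer G P) = ?n" using CD_measure_CD_lattice[OF PCD] n by simp
  then have "card ?X * card (centralizer G P) = ?p * card (centralizer G P)"
    using card_orbit_stabilizer[OF subgroup_self xc] pC unfolding C by linarith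
  then have "card ?X = ?p" using card_subgroup_pos[OF sC] by simp
  \<comment> \<open>\<open>P\<close> has only \<open>?p - 1\<close> nontrivial elements, too few for
    the \<open>?p\<close> conjugates of \<open>x\<close>.\<close>
  have "\<not> (\<forall>g\<in>carrier G. conjugate g x \<in> P)"
  proof
    assume "\<forall>g\<in>carrier G. conjugate g x \<in> P"
    then have "card ?X \<le> ?p - 1" by (intro card_le_if_orbit_subset(1)[OF P(1) x]) simp
    then show False using \<open>card ?X = ?p\<close> prime_gt_0_nat[OF P(2)] by linarith
  qed
  then obtain g where g: "g \<in> carrier G" "conjugate g x \<notin> P" by blast
  define y where "y = conjugate g x"
  define Q where "Q = conjugate g ` P"
  have yQ: "y \<in> Q" "y \<notin> P" using g x by (auto simp: y_def Q_def)
  have yc: "y \<in> carrier G" using g xc by (simp add: y_def)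
  have Q: "Q \<in> CD_lattice G" "subgroup Q G" "card Q = ?p"
    using g P PCD by (simp_all add: Q_def CD_lattice_conjugate subgroup_conjugate card_conjugate subgroup.subset)
  have "P \<inter> Q = {\<one>}" using P Q yQ by (intro prime_card_subgroups_Int) auto
  then have "card (P <#> Q) = ?p * ?p" using card_set_mult[OF P(1) Q(2)] Q(3) by simp
  moreover have "card (P <#> Q) * card (centralizer G (P <#> Q)) = ?n"
    using CD_measure_CD_lattice[OF CD_lattice_set_mult(2)[OF PCD Q(1)]] n by simp
  ultimately have "?p * (?p * card (centralizer G (P <#> Q))) = ?p * card (centralizer G P)"
    using pC by simp
  \<comment> \<open>\<open>P\<close> and its product with \<open>Q\<close> both have measure |G|, so
    the centralizer of the product has index \<open>?p\<close> in that of \<open>P\<close>. It is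
    the stabilizer of \<open>y\<close> there, so \<open>y\<close> should have \<open>?p\<close>
    conjugates under it.\<close>
  then have eq: "?p * card (centralizer G (P <#> Q)) = card (centralizer G P)"
    using prime_gt_0_nat[OF P(2)] by simp
  let ?Y = "(\<lambda>h. conjugate h y) ` centralizer G P"
  have Cc: "h \<in> carrier G" if "h \<in> centralizer G P" for h using that by (simp add: centralizer_def)
  \<comment> \<open>The centralizer of \<open>P\<close> fixes \<open>x\<close>, so it cannot move
    the different element \<open>y\<close> to \<open>x\<close>. This leaves at most
    \<open>?p - 1\<close> places for \<open>?Y\<close>.\<close>
  have "?Y \<subseteq> ?X - {x}"
  proof -
    have "conjugate h y \<in> ?X" "conjugate h y \<noteq> x" if h: "h \<in> centralizer G P" for h
    proof -
      have "conjugate h y = conjugate (h \<otimes> g) x"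
        using g xc Cc[OF h] by (simp add: y_def conjugate_def m_assoc inv_mult_group)
      then show "conjugate h y \<in> ?X" using g Cc[OF h] by auto
      show "conjugate h y \<noteq> x"
      proof
        assume "conjugate h y = x"
        moreover have "conjugate h x = x" using h C xc by (simp add: conjugate_eq_self_iff)
        ultimately have "conjugate h y = conjugate h x" by simp
        then have "y = x" using yc xc Cc[OF h] inj_on_conjugate by (metis inj_onD)
        then show False using x yQ by simp
      qed
    qed
    then show ?thesis by blast
  qed
  then have "card ?Y \<le> card (?X - {x})" by (intro card_mono) auto
  also have "\<dots> = ?p - 1"
  proof -
    have "conjugate \<one> x = x" using xc by (simp add: conjugate_def)
    then have "x \<in> ?X" by (metis image_eqI one_closed)
    then show ?thesis using \<open>card ?X = ?p\<close> by simp
  qed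
  finally have Y: "card ?Y \<le> ?p - 1" .
  have "generate G {y} = Q"
    using Q P yQ by (intro generate_eq_prime_card_subgroup) (auto simp: subgroup.one_closed)
  then have "{h \<in> centralizer G P. h \<otimes> y = y \<otimes> h} = centralizer G P \<inter> centralizer G Q"
    using mem_centralizer_generate_singleton_iff[OF yc] Cc by auto
  also have "\<dots> = centralizer G (P <#> Q)" using P Q by (simp add: centralizer_set_mult)
  finally have "card (centralizer G P) = card ?Y * card (centralizer G (P <#> Q))"
    using card_orbit_stabilizer[OF sC yc] by simp
  then have "?p * card (centralizer G (P <#> Q)) \<le> (?p - 1) * card (centralizer G (P <#> Q))"
    using mult_le_mono1[OF Y, of "card (centralizer G (P <#> Q))"] eq by linarith
  then have "?p \<le> ?p - 1 \<or> card (centralizer G (P <#> Q)) = 0" by (metis mult_le_cancel2 neq0_conv)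
  moreover have "card (centralizer G P) > 0" using sC by (rule card_subgroup_pos)
  ultimately show False using eq prime_gt_0_nat[OF P(2)] by (metis One_nat_def diff_Suc_less leD mult_0_right less_irrefl)
qed

text \<open>The only subgroup of prime order \<open>p\<close> is normal, so a generator
  \<open>x\<close> of it has fewer than \<open>p\<close> conjugates. If there were more than one, a
  prime divisor of their number would divide |G|, hence be \<open>p\<close> by uniqueness, which is
  too large. So \<open>x\<close> is central.\<close>

lemma unique_prime_card_subgroup_imp_center:
  assumes unique: "\<And>P Q. \<lbrakk>subgroup P G; Factorial_Ring.prime (card P); subgroup Q G;
      Factorial_Ring.prime (card Q)\<rbrakk> \<Longrightarrow> P = Q"
    and nontriv: "carrier G \<noteq> {\<one>}"
  shows "center \<noteq> {\<one>}"
proof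
  assume triv: "center = {\<one>}"
  have "card (carrier G) \<noteq> 1" using nontriv by (metis card_1_singletonE one_closed singletonD)
  then obtain p where p: "Factorial_Ring.prime p" "p dvd card (carrier G)" by (metis prime_factor_nat)
  obtain x where x: "x \<in> carrier G" "ord x = p" using prime_ord_exists[OF p(1) subgroup_self p(2)] .
  define M where "M = generate G {x}"
  have M: "subgroup M G" "card M = p" "x \<in> M"
    using x by (simp_all add: M_def subgroup_generate_singleton mem_generate_singleton flip: generate_pow_card)
  have "x \<noteq> \<one>" using x p(1) by auto
  have "conjugate g x \<in> M" if "g \<in> carrier G" for g
  proof -
    have "conjugate g ` M = M"
      using that M p(1) by (intro unique) (auto simp: subgroup_conjugate card_conjugate subgroup.subset)
    then show ?thesis using M(3) by blast
  qed
  note bound = card_le_if_orbit_subset(1)[OF M(1,3) \<open>x \<noteq> \<one>\<close> this]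
  let ?X = "(\<lambda>g. conjugate g x) ` carrier G"
  have orb: "card (carrier G) = card ?X * card {g \<in> carrier G. g \<otimes> x = x \<otimes> g}"
    by (rule card_orbit_stabilizer[OF subgroup_self x(1)])
  show False
  proof (cases "card ?X = 1")
    case True
    then have "{g \<in> carrier G. g \<otimes> x = x \<otimes> g} = carrier G"
      using orb by (intro card_subset_eq) auto
    then have "x \<otimes> g = g \<otimes> x" if "g \<in> carrier G" for g using that by (metis (mono_tags, lifting) mem_Collect_eq)
    then have "x \<in> center" using x by (simp add: centralizer_def)
    then show False using triv \<open>x \<noteq> \<one>\<close> by blast
  next
    case False
    then obtain q where q: "Factorial_Ring.prime q" "q dvd card ?X" by (metis prime_factor_nat)
    then have "q dvd card (carrier G)" using orb by simp
    then obtain y where y: "y \<in> carrier G" "ord y = q" using prime_ord_exists[OF q(1) subgroup_self] by blast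
    have "generate G {y} = M"
      using y q(1) M p(1) by (intro unique) (simp_all add: subgroup_generate_singleton flip: generate_pow_card)
    then have "q = p" using M y generate_pow_card by metis
    moreover have "card ?X > 0" using one_closed by (auto simp: card_gt_0_iff)
    ultimately have "p \<le> card ?X" using q(2) by (auto intro: dvd_imp_le)
    then show False using bound M prime_gt_0_nat[OF p(1)] by linarith
  qed
qed

text \<open>Treats the case that 1 is in CD(G), where the maximal measure is |G|. Conjugation
  permutes \<open>P\<close> and \<open>Q\<close>, being the only subgroups of prime order.\<close>

lemma two_missing_prime_card_subgroups:
  assumes P: "subgroup P G" "Factorial_Ring.prime (card P)"
    and Q: "subgroup Q G" "Factorial_Ring.prime (card Q)" and "P \<noteq> Q"
    and only: "\<And>R. \<lbrakk>subgroup R G; Factorial_Ring.prime (card R)\<rbrakk> \<Longrightarrow> R = P \<or> R = Q"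
    and CD: "\<And>R. \<lbrakk>subgroup R G; R \<noteq> P; R \<noteq> Q\<rbrakk> \<Longrightarrow> R \<in> CD_lattice G"
    and n: "max_CD_measure G = card (carrier G)"
  shows False
proof -
  note sub = P(1)[THEN subgroup.subset] Q(1)[THEN subgroup.subset]
  have I: "P \<inter> Q = {\<one>}" using P Q \<open>P \<noteq> Q\<close> by (rule prime_card_subgroups_Int)
  have "P \<noteq> {\<one>}" "Q \<noteq> {\<one>}" using P(2) Q(2) by auto
  then obtain x y where x: "x \<in> P" "x \<noteq> \<one>" and y: "y \<in> Q" "y \<noteq> \<one>"
    using P(1) Q(1) nontrivial_subgroupE by metis
  have xc: "x \<in> carrier G" and yc: "y \<in> carrier G" using x y sub by auto
  have gx: "generate G {x} = P" "ord x = card P" and gy: "generate G {y} = Q" "ord y = card Q"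
    using P Q x y generate_eq_prime_card_subgroup by auto
  have conj: "conjugate g ` R \<in> {P, Q}" if "R \<in> {P, Q}" "g \<in> carrier G" for R g
  proof -
    have "subgroup R G" "Factorial_Ring.prime (card R)" "R \<subseteq> carrier G" using that P Q sub by auto
    then show ?thesis using only[of "conjugate g ` R"] that(2) by (simp add: subgroup_conjugate card_conjugate)
  qed
  have cancel: "conjugate (inv g) ` conjugate g ` R = R" if "g \<in> carrier G" "R \<subseteq> carrier G" for g R
    using that by (force simp: image_image)
  show False
  proof (cases "card P = card Q")
    case True
    \<comment> \<open>\<open>x\<close> normalizes \<open>P\<close>; if it moved \<open>Q\<close>,
      conjugation by it would send both \<open>P\<close> and \<open>Q\<close> to
      \<open>P\<close>.\<close>
    have 1: "conjugate x ` Q = Q"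
    proof (rule ccontr)
      assume "conjugate x ` Q \<noteq> Q"
      then have "conjugate x ` Q = P" using conj[of Q x] xc by simp
      moreover have "conjugate x ` P = P" using P(1) x(1) by (rule conjugate_image_self)
      ultimately have "P = Q" using cancel[OF xc] sub by metis
      then show False using \<open>P \<noteq> Q\<close> by simp
    qed
    have 2: "conjugate y ` P = P"
    proof (rule ccontr)
      assume "conjugate y ` P \<noteq> P"
      then have "conjugate y ` P = Q" using conj[of P y] yc by simp
      moreover have "conjugate y ` Q = Q" using Q(1) y(1) by (rule conjugate_image_self)
      ultimately have "P = Q" using cancel[OF yc] sub by metis
      then show False using \<open>P \<noteq> Q\<close> by simp
    qed
    \<comment> \<open>The commutator of \<open>x\<close> and \<open>y\<close> is an element of
      \<open>Q\<close> in one bracketing and of \<open>P\<close> in the other, hence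
      trivial.\<close>
    have "conjugate x y \<in> Q" "conjugate y (inv x) \<in> P"
      using 1 2 y x subgroup.m_inv_closed[OF P(1)] by blast+
    then have "conjugate x y \<otimes> inv y \<in> Q" "x \<otimes> conjugate y (inv x) \<in> P"
      using x y P(1) Q(1) by (simp_all add: subgroup.m_closed subgroup.m_inv_closed)
    moreover have "conjugate x y \<otimes> inv y = x \<otimes> conjugate y (inv x)"
      using xc yc by (simp add: conjugate_def m_assoc)
    ultimately have "conjugate x y \<otimes> inv y = \<one>" using I by auto
    then have "conjugate x y = y" using xc yc by (metis conjugate_closed inv_equality inv_inv inv_closed)
    then have comm: "x \<otimes> y = y \<otimes> x" using xc yc by (simp add: conjugate_eq_self_iff)
    \<comment> \<open>The product lies in neither subgroup but has the same prime order, so it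
      generates a third one.\<close>
    define w where "w = x \<otimes> y"
    have wc: "w \<in> carrier G" using xc yc by (simp add: w_def)
    have wP: "w \<notin> P"
    proof
      assume "w \<in> P"
      then have "inv x \<otimes> w \<in> P" using x P(1) by (simp add: subgroup.m_closed subgroup.m_inv_closed)
      then have "y \<in> P" using xc yc by (simp add: w_def flip: m_assoc)
      then show False using y I by blast
    qed
    have wQ: "w \<notin> Q"
    proof
      assume "w \<in> Q"
      then have "w \<otimes> inv y \<in> Q" using y Q(1) by (simp add: subgroup.m_closed subgroup.m_inv_closed)
      then have "x \<in> Q" using xc yc by (simp add: w_def m_assoc)
      then show False using x I by blast
    qed
    have "w \<noteq> \<one>" using wP P(1) subgroup.one_closed by blast
    have "w [^] card P = \<one>" using xc yc gx gy True comm
      by (metis pow_mult_distrib pow_ord_eq_1 r_one one_closed w_def)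
    then have "ord w dvd card P" using wc pow_eq_id by blast
    then have "ord w = card P" using P(2) wc \<open>w \<noteq> \<one>\<close> ord_eq_1 by (metis prime_nat_iff)
    then have "generate G {w} = P \<or> generate G {w} = Q"
      using wc P(2) by (intro only) (simp_all add: subgroup_generate_singleton flip: generate_pow_card)
    then show False using wP wQ mem_generate_singleton[of w] by blast
  next
    case False
    \<comment> \<open>Different orders keep conjugation from exchanging the two subgroups, so both
      are normal.\<close>
    have "conjugate g ` P = P" "conjugate g ` Q = Q" if "g \<in> carrier G" for g
      using conj[OF _ that, of P] conj[OF _ that, of Q] card_conjugate[OF that] sub False by auto
    then have "conjugate g x \<in> P" "conjugate g y \<in> Q" if "g \<in> carrier G" for g
      using that x y by blast+
    then have b1: "card (carrier G) \<le> (card P - 1) * card (centralizer G P)"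
      and b2: "card (carrier G) \<le> (card Q - 1) * card (centralizer G Q)"
      using card_le_if_orbit_subset(2)[OF P(1) x] card_le_if_orbit_subset(2)[OF Q(1) y] gx gy by simp_all
    define n where "n = card (carrier G)"
    define J where "J = generate G (P \<union> Q)"
    define c where "c = card (centralizer G J)"
    have sJ: "subgroup J G" unfolding J_def using sub by (intro generate_is_subgroup) auto
    have PJ: "P \<subseteq> J" "Q \<subseteq> J" by (auto simp: J_def intro: generate.incl)
    have "J \<noteq> P" "J \<noteq> Q" using PJ I x y by blast+
    then have "J \<in> CD_lattice G" using sJ CD by blast
    then have nJ: "card J * c = n" using CD_measure_CD_lattice n by (simp add: c_def n_def)
    have "P <#> Q \<subseteq> J" using PJ sJ by (auto simp: set_mult_def subgroup.m_closed subset_iff)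
    then have "card (P <#> Q) \<le> card J" using sJ by (simp add: card_mono finite_subgroup)
    moreover have "card (P <#> Q) = card P * card Q" using card_set_mult[OF P(1) Q(1)] I by simp
    ultimately have n1: "card P * card Q * c \<le> n" using nJ by (metis mult_le_mono1)
    have CJ: "centralizer G J = centralizer G P \<inter> centralizer G Q"
      using sub by (simp add: J_def centralizer_generate centralizer_Un)
    have "card (centralizer G P) * card (centralizer G Q) = card (centralizer G P <#> centralizer G Q) * c"
      unfolding c_def CJ using sub by (simp add: card_set_mult subgroup_centralizer)
    also have "\<dots> \<le> n * c"
      unfolding n_def using centralizer_subset by (intro mult_le_mono1 card_mono set_mult_closed) auto
    finally have n2: "card (centralizer G P) * card (centralizer G Q) \<le> n * c" .
    \<comment> \<open>The two orbit bounds are multiplied; the product formula bounds the product of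
      the centralizers by \<open>n * c\<close>, as they intersect in the centralizer of
      \<open>J\<close>. Cancelling \<open>n\<close> contradicts \<open>n1\<close>.\<close>
    have "n * n \<le> ((card P - 1) * card (centralizer G P)) * ((card Q - 1) * card (centralizer G Q))"
      using b1 b2 unfolding n_def by (rule mult_le_mono)
    also have "\<dots> = (card P - 1) * (card Q - 1) * (card (centralizer G P) * card (centralizer G Q))"
      by (simp add: ac_simps)
    also have "\<dots> \<le> (card P - 1) * (card Q - 1) * (n * c)" using n2 by (rule mult_le_mono2)
    finally have "n * n \<le> n * ((card P - 1) * (card Q - 1) * c)" by (simp add: ac_simps)
    moreover have "n > 0" unfolding n_def using card_subgroup_pos subgroup_self by blast
    ultimately have "n \<le> (card P - 1) * (card Q - 1) * c" by simp
    then have le: "card P * card Q * c \<le> (card P - 1) * (card Q - 1) * c" using n1 by linarith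
    have "c > 0" using nJ \<open>n > 0\<close> by (metis mult_0_right neq0_conv)
    then have "card P * card Q \<le> (card P - 1) * (card Q - 1)" using le by simp
    also have "\<dots> \<le> (card P - 1) * card Q" by simp
    also have "\<dots> < card P * card Q" using P(2) Q(2) prime_gt_0_nat by simp
    finally show False by simp
  qed
qed

theorem center_nontrivial:
  assumes miss: "card (subgroup_lattice G - CD_lattice G) \<le> 2" and nontriv: "carrier G \<noteq> {\<one>}"
  shows "center \<noteq> {\<one>}"
proof
  assume triv: "center = {\<one>}"
  let ?M = "subgroup_lattice G - CD_lattice G"
  have fM: "finite ?M" using finite_subgroup_lattice by simp
  \<comment> \<open>Once two missing subgroups are known, a third would exceed the bound.\<close>
  have M: "R \<in> CD_lattice G" if "subgroup R G" "A \<in> ?M" "B \<in> ?M" "A \<noteq> B" "R \<noteq> A" "R \<noteq> B" for R A B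
  proof (rule ccontr)
    assume "R \<notin> CD_lattice G"
    then have "{A, B, R} \<subseteq> ?M" using that by (auto simp: subgroup_lattice_def)
    then have "card {A, B, R} \<le> card ?M" using fM card_mono by blast
    then show False using that miss by (simp split: if_splits)
  qed
  have unique: "\<not> (\<forall>P Q. subgroup P G \<and> Factorial_Ring.prime (card P) \<and> subgroup Q G
      \<and> Factorial_Ring.prime (card Q) \<longrightarrow> P = Q)"
    using unique_prime_card_subgroup_imp_center nontriv triv by blast
  then obtain P Q where PQ: "subgroup P G" "Factorial_Ring.prime (card P)" "subgroup Q G"
      "Factorial_Ring.prime (card Q)" "P \<noteq> Q" by blast
  show False
  proof (cases "{\<one>} \<in> CD_lattice G")
    case True
    then have miss': "R \<in> ?M" if "subgroup R G" "Factorial_Ring.prime (card R)" for R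
      using that prime_card_not_in_CD_lattice by (auto simp: subgroup_lattice_def)
    have "R = P \<or> R = Q" if "subgroup R G" "Factorial_Ring.prime (card R)" for R
      using M[of R P Q] miss' that PQ by blast
    then show False
      using PQ M[OF _ miss' miss', of _ P Q] carrier_in_CD_lattice_if_triv(2)[OF True]
      by (intro two_missing_prime_card_subgroups[of P Q]) auto
  next
    case False
    \<comment> \<open>With trivial center, G and 1 have the same measure, so they are missing
      together and use up both exceptions.\<close>
    moreover have "CD_measure G (carrier G) = CD_measure G {\<one>}"
      by (simp add: CD_measure_triv) (simp add: CD_measure_def triv)
    ultimately have miss': "{\<one>} \<in> ?M" "carrier G \<in> ?M"
      using subgroup_self triv_subgroup by (auto simp: subgroup_lattice_def CD_lattice_def)
    have "R \<in> CD_lattice G" if R: "subgroup R G" "Factorial_Ring.prime (card R)" for R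
    proof -
      have "R \<noteq> {\<one>}" using R by auto
      \<comment> \<open>A group of prime order is cyclic, hence equal to its center, which is
        trivial here.\<close>
      moreover have "R \<noteq> carrier G"
      proof
        assume RG: "R = carrier G"
        obtain x where x: "x \<in> R" "x \<noteq> \<one>" using R \<open>R \<noteq> {\<one>}\<close> nontrivial_subgroupE by metis
        then have gx: "generate G {x} = carrier G" using generate_eq_prime_card_subgroup R RG by blast
        have xc: "x \<in> carrier G" using x RG by simp
        then have "x \<in> centralizer G (generate G {x})" by (simp add: mem_centralizer_generate_singleton_iff)
        then show False using gx triv x by simp
      qed
      ultimately show ?thesis using M[OF R(1) miss'] nontriv by metis
    qed
    then have "P \<inter> Q \<in> CD_lattice G" using PQ CD_lattice_set_mult(3) by blast
    then show False using False PQ prime_card_subgroups_Int by metis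
  qed
qed

end


section \<open>Non-abelian groups with nontrivial center\<close>

text \<open>Collecting all factors \<open>r\<close> on the left makes \<open>n choose 2\<close> of
  them cross a factor \<open>y\<close>, and each crossing leaves one \<open>v\<close>, which
  commutes with both.\<close>

lemma (in group) pow_mult_commutator:
  assumes "r \<in> carrier G" "y \<in> carrier G" "v \<in> carrier G"
    and yX: "y \<otimes> r = r \<otimes> y \<otimes> v" and vX: "v \<otimes> r = r \<otimes> v" and vy: "v \<otimes> y = y \<otimes> v"
  shows "(r \<otimes> y) [^] (n::nat) = r [^] n \<otimes> y [^] n \<otimes> v [^] (n choose 2)"
proof -
  have comm: "v [^] (k::nat) \<otimes> r = r \<otimes> v [^] k" "v [^] k \<otimes> y = y \<otimes> v [^] k" for k
    using assms group_commutes_pow by auto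
  have ynX: "y [^] (n::nat) \<otimes> r = r \<otimes> y [^] n \<otimes> v [^] n" for n
  proof (induction n)
    case (Suc n)
    have "y [^] Suc n \<otimes> r = y [^] n \<otimes> (r \<otimes> y \<otimes> v)" using assms by (simp add: m_assoc flip: yX)
    also have "\<dots> = (y [^] n \<otimes> r) \<otimes> (y \<otimes> v)" using assms by (simp add: m_assoc)
    also have "\<dots> = r \<otimes> y [^] n \<otimes> (v [^] n \<otimes> y) \<otimes> v" using assms by (simp add: Suc m_assoc)
    also have "\<dots> = r \<otimes> y [^] Suc n \<otimes> v [^] Suc n" using assms by (simp add: comm m_assoc)
    finally show ?case .
  qed (use assms in simp)
  show ?thesis
  proof (induction n)
    case (Suc n)
    let ?c = "v [^] (n choose 2)"
    have "(r \<otimes> y) [^] Suc n = r [^] n \<otimes> y [^] n \<otimes> (?c \<otimes> r) \<otimes> y" using assms by (simp add: Suc m_assoc)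
    also have "\<dots> = r [^] n \<otimes> (y [^] n \<otimes> r) \<otimes> (?c \<otimes> y)" using assms by (simp add: comm(1) m_assoc)
    also have "\<dots> = r [^] n \<otimes> r \<otimes> y [^] n \<otimes> (v [^] n \<otimes> y) \<otimes> ?c"
      using assms unfolding comm(2)[of "n choose 2"] by (simp add: ynX m_assoc)
    also have "\<dots> = r [^] Suc n \<otimes> y [^] Suc n \<otimes> (v [^] n \<otimes> ?c)" using assms unfolding comm(2) by (simp add: m_assoc)
    also have "v [^] n \<otimes> ?c = v [^] (Suc n choose 2)" using assms by (simp add: nat_pow_mult numeral_2_eq_2)
    finally show ?case .
  qed (use assms in \<open>simp add: numeral_2_eq_2\<close>)
qed

text \<open>The situation to which \<open>non_abelian_imp_iso_Q8\<close> reduces the non-abelian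
  case. \<open>K\<close> is the possible second missing subgroup; if only the trivial subgroup is
  missing, \<open>K\<close> can be taken to be that one.\<close>

locale CD_lattice_almost_all = finite_group +
  fixes K
  assumes K_normal: "g \<in> carrier G \<Longrightarrow> conjugate g ` K = K"
    and CD: "\<lbrakk>subgroup H G; H \<noteq> {\<one>}; H \<noteq> K\<rbrakk> \<Longrightarrow> H \<in> CD_lattice G"
    and carrier_CD: "carrier G \<in> CD_lattice G"
    and center_cases: "subgroup H G \<Longrightarrow> \<not> H \<subseteq> center \<Longrightarrow> center \<subseteq> H"
    and non_abelian: "center \<noteq> carrier G"
    and center_nontriv: "center \<noteq> {\<one>}"
begin

lemma center_closed: "z \<in> center \<Longrightarrow> z \<in> carrier G"
  by (simp add: centralizer_def)

lemma center_subset_generate: "x \<in> carrier G \<Longrightarrow> x \<notin> center \<Longrightarrow> center \<subseteq> generate G {x}"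
  using center_cases subgroup_generate_singleton mem_generate_singleton by blast

lemma card_center_neq_1: "card center \<noteq> 1"
  using center_nontriv subgroup.one_closed[OF subgroup_center] by (metis card_1_singletonE singletonD)

text \<open>Otherwise the center lies in the subgroup generated by \<open>w\<close>, whose order
  divides \<open>p\<close>. As the center is nontrivial, the two coincide and \<open>w\<close> is
  central after all.\<close>

lemma pow_prime_eq_one_imp_center:
  assumes p: "Factorial_Ring.prime (p::nat)" and w: "w \<in> carrier G" "w [^] p = \<one>"
  shows "w \<in> center"
proof (rule ccontr)
  assume "w \<notin> center"
  then have sub: "center \<subseteq> generate G {w}" using w by (intro center_subset_generate)
  then have dvd: "card center dvd ord w"
    using w by (simp add: card_subgroup_dvd subgroup_center subgroup_generate_singleton generate_pow_card)
  have "ord w dvd p" using w pow_eq_id by blast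
  then have "card center = p" using p dvd card_center_neq_1 by (metis dvd_trans prime_nat_iff)
  then have "center = generate G {w}" using sub w \<open>ord w dvd p\<close> p
    by (intro subgroup_eqI_card) (auto simp: subgroup_generate_singleton dvd_imp_le prime_gt_0_nat simp flip: generate_pow_card)
  then show False using \<open>w \<notin> center\<close> mem_generate_singleton by blast
qed

text \<open>For prime \<open>p\<close> these are the elements whose image modulo the center has
  order exactly \<open>p\<close>.\<close>

definition good :: "nat \<Rightarrow> 'a \<Rightarrow> bool" where
  "good p x \<longleftrightarrow> x \<in> carrier G \<and> x \<notin> center \<and> x [^] p \<in> center"

lemma card_center_dvd_ord: "x \<in> carrier G \<Longrightarrow> x \<notin> center \<Longrightarrow> card center dvd ord x"
  using center_subset_generate
  by (simp add: card_subgroup_dvd subgroup_center subgroup_generate_singleton generate_pow_card)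

context
  fixes p :: nat
  assumes p: "Factorial_Ring.prime p" "p dvd card center"
begin

text \<open>Taking \<open>p\<close>-th powers repeatedly divides the order by \<open>p\<close>,
  because \<open>p\<close> divides |Z|, which divides the order of every non-central element. The
  last non-central power is good.\<close>

lemma good_power_exists:
  assumes "w \<in> carrier G" "w \<notin> center"
  shows "\<exists>j::nat. good p (w [^] j)"
  using assms
proof (induction "ord w" arbitrary: w rule: less_induct)
  case less
  show ?case
  proof (cases "w [^] p \<in> center")
    case True
    then have "good p (w [^] (1::nat))" using less.prems by (simp add: good_def)
    then show ?thesis by blast
  next
    case False
    have "p dvd ord w" using card_center_dvd_ord[OF less.prems] p(2) by (rule dvd_trans[rotated])
    then have "ord (w [^] p) = ord w div p" using less.prems p(1) prime_gt_0_nat by (intro ord_pow) auto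
    also have "\<dots> < ord w" by (intro div_less_dividend prime_gt_1_nat p ord_pos less.prems)
    finally have "\<exists>j::nat. good p ((w [^] p) [^] j)" using less False by simp
    then show ?thesis using less.prems by (auto simp: nat_pow_pow)
  qed
qed

text \<open>With \<open>m\<close> the order of the central element \<open>x [^] p\<close>, the order
  of \<open>x\<close> is \<open>p * m\<close> and |Z| is \<open>m * t\<close>. Since |Z| divides the
  order of \<open>x\<close>, \<open>t\<close> divides \<open>p\<close>; \<open>t = p\<close> would
  make \<open>x\<close> a generator of the center.\<close>

lemma good_generate:
  assumes "good p x"
  shows "ord x = p * card center" "generate G {x [^] p} = center"
proof -
  have x: "x \<in> carrier G" "x \<notin> center" "x [^] p \<in> center" using assms by (auto simp: good_def)
  define m where "m = ord (x [^] p)"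
  have "p dvd ord x" using card_center_dvd_ord[OF x(1,2)] p(2) by (rule dvd_trans[rotated])
  moreover from this have "m = ord x div p" 
    unfolding m_def using x p(1) prime_gt_0_nat by (intro ord_pow) auto
  ultimately have n: "ord x = p * m" by simp
  have "m dvd card center" unfolding m_def using x subgroup_center by (intro ord_dvd_card_subgroup)
  then obtain t where t: "card center = m * t" by (auto elim: dvdE)
  have "m > 0" using n ord_pos[OF x(1)] by (metis mult_0_right neq0_conv)
  have "m * t dvd p * m" using card_center_dvd_ord[OF x(1,2)] by (simp add: n t)
  then have "t dvd p" using \<open>m > 0\<close> by (simp add: mult.commute)
  moreover have "t \<noteq> p"
  proof
    assume "t = p"
    then have "center = generate G {x}"
      using x n t by (intro subgroup_eqI_card center_subset_generate)
        (auto simp: subgroup_generate_singleton mult.commute simp flip: generate_pow_card)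
    then show False using x mem_generate_singleton by blast
  qed
  ultimately have "t = 1" using p(1) by (metis prime_nat_iff)
  then have c: "card center = m" using t by simp
  then show "ord x = p * card center" using n by simp
  show "generate G {x [^] p} = center"
    using x c by (intro subgroup_eqI_card[OF subgroup_center] generate_singleton_subset subgroup_center)
      (auto simp: m_def simp flip: generate_pow_card)
qed

text \<open>As \<open>x [^] p\<close> generates the center, the inverse of \<open>y [^] p\<close> is
  one of its powers.\<close>

lemma good_cancel_pow:
  assumes "good p x" "good p y"
  obtains k :: nat where "(x [^] k) [^] p \<otimes> y [^] p = \<one>"
proof -
  have x: "x \<in> carrier G" "y \<in> carrier G" "y [^] p \<in> center" using assms by (auto simp: good_def)
  then have "inv (y [^] p) \<in> center" using subgroup_center by (simp add: subgroup.m_inv_closed)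
  then obtain k where "inv (y [^] p) = (x [^] p) [^] (k::nat)"
    using good_generate(2)[OF assms(1)] x generate_singleton[of "x [^] p"] by auto
  then have "(x [^] k) [^] p \<otimes> y [^] p = \<one>" using x by (metis l_inv mult.commute nat_pow_closed nat_pow_pow)
  then show thesis by (rule that)
qed

text \<open>For the \<open>k\<close> that cancels the \<open>p\<close>-th powers,
  \<open>x [^] k \<otimes> y\<close> has \<open>p\<close>-th power 1. It is therefore central and
  lies in the subgroup generated by \<open>x\<close>.\<close>

lemma good_commute_imp_mem:
  assumes "good p x" "good p y" and xy: "x \<otimes> y = y \<otimes> x"
  shows "y \<in> generate G {x}"
proof -
  have x: "x \<in> carrier G" "x \<notin> center" "y \<in> carrier G" using assms by (auto simp: good_def)
  obtain k :: nat where k: "(x [^] k) [^] p \<otimes> y [^] p = \<one>" using good_cancel_pow assms by blast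
  have "x [^] k \<otimes> y = y \<otimes> x [^] k" using x xy group_commutes_pow by auto
  then have "(x [^] k \<otimes> y) [^] p = \<one>" using x k by (metis nat_pow_closed pow_mult_distrib)
  then have "x [^] k \<otimes> y \<in> center" using x p by (intro pow_prime_eq_one_imp_center) auto
  then have "x [^] k \<otimes> y \<in> generate G {x}" using center_subset_generate x by blast
  moreover have "inv (x [^] k) \<in> generate G {x}"
    using x subgroup_generate_singleton by (simp add: mem_generate_singleton subgroup.m_inv_closed subgroup_pow_closed)
  ultimately have "inv (x [^] k) \<otimes> (x [^] k \<otimes> y) \<in> generate G {x}"
    using x subgroup_generate_singleton subgroup.m_closed by metis
  then show ?thesis using x by (simp flip: m_assoc)
qed

text \<open>Take a good \<open>x\<close>, some \<open>g\<close> not commuting with it, and a good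
  power of \<open>g\<close>. If \<open>x\<close> commuted with that power, it would be a power of
  \<open>g\<close> itself.\<close>

lemma good_noncommuting_exist:
  obtains x y where "good p x" "good p y" "x \<otimes> y \<noteq> y \<otimes> x"
proof -
  obtain w where "w \<in> carrier G" "w \<notin> center" using non_abelian centralizer_subset by blast
  then obtain i :: nat where "good p (w [^] i)" using good_power_exists by blast
  then obtain x where x: "good p x" by blast
  then have xc: "x \<in> carrier G" by (simp add: good_def)
  then obtain g where g: "g \<in> carrier G" "x \<otimes> g \<noteq> g \<otimes> x" using x by (auto simp: good_def centralizer_def)
  then have "g \<notin> center" using center_commute xc by metis
  then obtain j :: nat where y: "good p (g [^] j)" using good_power_exists g by blast
  have "x \<otimes> g [^] j \<noteq> g [^] j \<otimes> x"
  proof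
    assume "x \<otimes> g [^] j = g [^] j \<otimes> x"
    then have "x \<in> generate G {g [^] j}" using x y by (intro good_commute_imp_mem) auto
    then obtain l :: nat where "x = (g [^] j) [^] l" using g generate_singleton by auto
    then show False using g group_commutes_pow by (metis nat_pow_pow)
  qed
  then show thesis using that x y by blast
qed

text \<open>The order of the intersection is a multiple of |Z| dividing
  \<open>p * card center\<close>; since \<open>A\<close> and \<open>B\<close> differ, the
  intersection has order exactly |Z|.\<close>

lemma card_set_mult_generate:
  assumes A: "subgroup A G" "center \<subseteq> A" "card A = p * card center"
    and B: "subgroup B G" "center \<subseteq> B" "card B = p * card center" and "A \<noteq> B"
  shows "card (A <#> B) = p * p * card center"
proof -
  have I: "subgroup (A \<inter> B) G" using A B subgroups_Inter_pair by blast
  have "card center dvd card (A \<inter> B)" using A B I by (intro card_subgroup_dvd subgroup_center) auto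
  then obtain t where t: "card (A \<inter> B) = card center * t" by (auto elim: dvdE)
  have "card center > 0" using card_subgroup_pos subgroup_center by blast
  have "card (A \<inter> B) dvd card A" using A I by (intro card_subgroup_dvd) auto
  then have "t dvd p" using t A \<open>card center > 0\<close> by (simp add: mult.commute)
  moreover have "t \<noteq> p"
  proof
    assume "t = p"
    then have "card A \<le> card (A \<inter> B)" "card B \<le> card (A \<inter> B)" using t A B by (simp_all add: mult.commute)
    then have "A \<inter> B = A" "A \<inter> B = B"
      using subgroup_eqI_card[OF A(1), of "A \<inter> B"] subgroup_eqI_card[OF B(1), of "A \<inter> B"] by auto
    then show False using \<open>A \<noteq> B\<close> by blast
  qed
  ultimately have "t = 1" using p(1) by (metis prime_nat_iff)
  then have "card (A \<inter> B) = card center" using t by simp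
  then have "card (A <#> B) * card center = (p * p * card center) * card center"
    using card_set_mult[OF A(1) B(1)] A B by (simp add: ac_simps)
  then show ?thesis using \<open>card center > 0\<close> by simp
qed

lemma good_generate_neq:
  assumes "good p x" "good p y" "x \<otimes> y \<noteq> y \<otimes> x" shows "generate G {x} \<noteq> generate G {y}"
proof
  assume "generate G {x} = generate G {y}"
  moreover have "x \<in> carrier G" "y \<in> carrier G" using assms by (auto simp: good_def)
  ultimately obtain k :: nat where "y = x [^] k" using generate_singleton mem_generate_singleton by blast
  then show False using assms(3) \<open>x \<in> carrier G\<close> group_commutes_pow by metis
qed

lemma good_facts:
  assumes "good p x"
  shows "subgroup (generate G {x}) G" "center \<subseteq> generate G {x}" "card (generate G {x}) = p * card center"
    "generate G {x} \<noteq> {\<one>}"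
proof -
  have x: "x \<in> carrier G" "x \<notin> center" using assms by (auto simp: good_def)
  then show "subgroup (generate G {x}) G" "center \<subseteq> generate G {x}" "card (generate G {x}) = p * card center"
    using good_generate(1)[OF assms] 
    by (simp_all add: subgroup_generate_singleton center_subset_generate flip: generate_pow_card)
  have "x \<noteq> \<one>" using x subgroup.one_closed[OF subgroup_center] by blast
  then show "generate G {x} \<noteq> {\<one>}" using mem_generate_singleton by blast
qed

text \<open>If \<open>A = \<langle>x\<rangle>\<close> is not normalised by \<open>y\<close>, then \<open>A\<^sup>y\<close> permutes with \<open>A\<close> and \<open>A A\<^sup>y\<close> fills \<open>A \<langle>y\<rangle>\<close>;
  but writing the inverse of \<open>y\<close> as an element of \<open>A A\<^sup>y\<close> shows \<open>y \<in> A\<close>.\<close>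

lemma conjugate_mem_generate:
  assumes xy: "good p x" "good p y" "x \<otimes> y \<noteq> y \<otimes> x"
    and AB: "generate G {x} \<in> CD_lattice G" "generate G {y} \<in> CD_lattice G"
  shows "conjugate y x \<in> generate G {x}"
proof (rule ccontr)
  define A where "A = generate G {x}"
  define B where "B = generate G {y}"
  define A' where "A' = conjugate y ` A"
  have x: "x \<in> carrier G" "y \<in> carrier G" using xy by (auto simp: good_def)
  have A: "subgroup A G" "center \<subseteq> A" "card A = p * card center" "x \<in> A"
    and B: "subgroup B G" "center \<subseteq> B" "card B = p * card center" "y \<in> B"
    using good_facts xy by (simp_all add: A_def B_def mem_generate_singleton)
  have A': "A' \<in> CD_lattice G" "subgroup A' G" "card A' = p * card center"
    using x A AB by (simp_all add: A'_def CD_lattice_conjugate subgroup_conjugate card_conjugate subgroup.subset flip: A_def)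
  assume "conjugate y x \<notin> generate G {x}"
  then have "A \<noteq> A'" using A by (auto simp: A_def A'_def)
  have AB_card: "card (A <#> B) = p * p * card center"
    using A B good_generate_neq[OF xy] by (intro card_set_mult_generate) (auto simp: A_def B_def)
  have AA'_card: "card (A <#> A') = p * p * card center"
    using A A' \<open>A \<noteq> A'\<close> center_subset_CD_lattice by (intro card_set_mult_generate) auto
  have H: "subgroup (A <#> B) G" using AB by (simp add: A_def B_def CD_lattice_set_mult)
  have mem: "a \<in> A <#> B" if "a \<in> A" for a
    using that subset_set_mult[OF A(1) B(1)] by blast
  have yH: "y \<in> A <#> B"
    using B(4) subset_set_mult[OF A(1) B(1)] by blast
  \<comment> \<open>\<open>A <#> B\<close> is a subgroup containing \<open>A\<close> and
    \<open>y\<close>, hence also the conjugate \<open>A'\<close>. Comparing orders turns the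
    inclusion into an equality.\<close>
  have "A <#> A' \<subseteq> A <#> B"
  proof
    fix h assume "h \<in> A <#> A'"
    then obtain a a' where "a \<in> A" "a' \<in> A" "h = a \<otimes> (y \<otimes> a' \<otimes> inv y)"
      by (auto simp: set_mult_def A'_def conjugate_def)
    then show "h \<in> A <#> B" using mem yH H by (simp add: subgroup.m_closed subgroup.m_inv_closed)
  qed
  then have "A <#> A' = A <#> B" using AB_card AA'_card H by (intro subgroup_eqI_card) auto
  then have "inv y \<in> A <#> A'" using yH H subgroup.m_inv_closed by metis
  then obtain a a' where a: "a \<in> A" "a' \<in> A" "inv y = a \<otimes> (y \<otimes> a' \<otimes> inv y)"
    by (auto simp: set_mult_def A'_def conjugate_def)
  then have ac: "a \<in> carrier G" "a' \<in> carrier G" using subgroup.mem_carrier[OF A(1)] by blast+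
  \<comment> \<open>The trailing \<open>inv y\<close> cancels, and what remains expresses
    \<open>y\<close> by elements of \<open>A\<close>.\<close>
  then have "\<one> = a \<otimes> (y \<otimes> a')" using a(3) x by (metis inv_closed l_inv m_assoc m_closed r_one inv_solve_right' l_one)
  then have "y = inv a \<otimes> inv a'" using ac x
    by (metis inv_closed inv_solve_left inv_solve_right m_closed r_one l_one)
  then have "y \<in> A" using a A by (simp add: subgroup.m_closed subgroup.m_inv_closed)
  then obtain k :: nat where "y = x [^] k" using generate_singleton x by (auto simp: A_def)
  then show False using xy(3) x group_commutes_pow by metis
qed

text \<open>If one of the two generates \<open>K\<close>, that subgroup is normal and the roles can
  be chosen accordingly. Otherwise both cyclic subgroups are in CD(G) and
  \<open>conjugate_mem_generate\<close> applies.\<close>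

lemma good_normalizing_exist:
  obtains x y where "good p x" "good p y" "x \<otimes> y \<noteq> y \<otimes> x" "conjugate y x \<in> generate G {x}"
proof -
  obtain x y where xy: "good p x" "good p y" "x \<otimes> y \<noteq> y \<otimes> x" by (rule good_noncommuting_exist)
  have x: "x \<in> carrier G" "y \<in> carrier G" using xy by (auto simp: good_def)
  consider "generate G {x} = K" | "generate G {y} = K" | "generate G {x} \<noteq> K" "generate G {y} \<noteq> K" by blast
  then show thesis
  proof cases
    case 1
    then have "conjugate y x \<in> generate G {x}" using K_normal[OF x(2)] mem_generate_singleton by blast
    then show thesis using that xy by blast
  next
    case 2
    then have "conjugate x y \<in> generate G {y}" using K_normal[OF x(1)] mem_generate_singleton by blast
    then show thesis using that xy by metis
  next
    case 3
    then have "conjugate y x \<in> generate G {x}"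
      using good_facts[OF xy(1)] good_facts[OF xy(2)] by (intro conjugate_mem_generate xy CD)
    then show thesis using that xy by blast
  qed
qed

text \<open>The element \<open>u = inv x \<otimes> conjugate y x\<close> is a power of
  \<open>x\<close>, so it commutes with \<open>x\<close>. Conjugation by \<open>y\<close> fixes the
  central \<open>x [^] p\<close>, whence \<open>u [^] p = \<one>\<close> and \<open>u\<close> is
  central.\<close>

lemma good_commutator:
  assumes xy: "good p x" "good p y" "x \<otimes> y \<noteq> y \<otimes> x" "conjugate y x \<in> generate G {x}"
  obtains u where "u \<in> center" "u \<noteq> \<one>" "u [^] p = \<one>" "y \<otimes> x = x \<otimes> y \<otimes> u"
proof -
  have x: "x \<in> carrier G" "y \<in> carrier G" "x [^] p \<in> center" using xy by (auto simp: good_def)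
  obtain k :: nat where k: "conjugate y x = x [^] k" using xy x generate_singleton by auto
  define u where "u = inv x \<otimes> conjugate y x"
  have uc: "u \<in> carrier G" using x by (simp add: u_def)
  have xu: "conjugate y x = x \<otimes> u" using x by (simp add: u_def flip: m_assoc)
  have comm: "x \<otimes> u = u \<otimes> x"
    using x k group_commutes_pow[of x x k] by (simp add: u_def m_assoc) (simp flip: m_assoc)
  have "x [^] p = conjugate y (x [^] p)"
    using x center_commute[OF x(3) x(2)] by (metis conjugate_eq_self_iff nat_pow_closed)
  also have "\<dots> = x [^] p \<otimes> u [^] p" using x uc by (simp add: conjugate_pow xu pow_mult_distrib[OF comm])
  finally have up: "u [^] p = \<one>" using x uc by simp
  then have "u \<in> center" using uc p by (intro pow_prime_eq_one_imp_center) auto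
  moreover have yx: "y \<otimes> x = x \<otimes> y \<otimes> u"
  proof -
    have "y \<otimes> x = x \<otimes> u \<otimes> y" using xu x uc unfolding conjugate_def by (metis inv_solve_right' m_closed)
    then show ?thesis using x uc center_commute[OF \<open>u \<in> center\<close> x(2)] by (simp add: m_assoc)
  qed
  moreover have "u \<noteq> \<one>" using yx xy(3) x by auto
  ultimately show thesis using that up by blast
qed

lemma prime_eq_2_and_card_center_eq_2: "p = 2" "card center = 2"
proof -
  obtain x y where xy: "good p x" "good p y" "x \<otimes> y \<noteq> y \<otimes> x" "conjugate y x \<in> generate G {x}"
    by (rule good_normalizing_exist)
  obtain u where u: "u \<in> center" "u \<noteq> \<one>" "u [^] p = \<one>" "y \<otimes> x = x \<otimes> y \<otimes> u"
    using good_commutator xy by blast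
  obtain k :: nat where k: "(x [^] k) [^] p \<otimes> y [^] p = \<one>" using good_cancel_pow xy by blast
  have x: "x \<in> carrier G" "y \<in> carrier G" "u \<in> carrier G" using xy u by (auto simp: good_def center_closed)
  \<comment> \<open>The exponent \<open>k\<close> cancels the \<open>p\<close>-th powers of
    \<open>r\<close> and \<open>y\<close>, so only the commutator term survives in
    \<open>w [^] p\<close>.\<close>
  define r where "r = x [^] k"
  define v where "v = u [^] k"
  define w where "w = r \<otimes> y"
  have v: "v \<in> center" using u subgroup_center by (simp add: v_def subgroup_pow_closed)
  have c: "r \<in> carrier G" "v \<in> carrier G" "w \<in> carrier G" using x by (auto simp: r_def v_def w_def)
  have vp: "v [^] p = \<one>" using x u unfolding v_def by (metis mult.commute nat_pow_one nat_pow_pow)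
  have "y \<otimes> x [^] k = x [^] k \<otimes> y \<otimes> u [^] k" for k :: nat
  proof (induction k)
    case (Suc k)
    have uk: "u [^] k \<otimes> x = x \<otimes> u [^] k"
      using u subgroup_center x by (intro center_commute) (simp_all add: subgroup_pow_closed)
    have "y \<otimes> x [^] Suc k = x [^] k \<otimes> y \<otimes> (u [^] k \<otimes> x)" using x Suc by (simp flip: m_assoc)
    also have "\<dots> = x [^] k \<otimes> (y \<otimes> x) \<otimes> u [^] k" using x by (simp add: uk m_assoc)
    also have "\<dots> = x [^] Suc k \<otimes> y \<otimes> (u \<otimes> u [^] k)" using x by (simp add: u(4) m_assoc)
    also have "u \<otimes> u [^] k = u [^] Suc k" using x(3) by (rule nat_pow_Suc2[symmetric])
    finally show ?case .
  qed (use x in simp)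
  then have "y \<otimes> r = r \<otimes> y \<otimes> v" by (simp add: r_def v_def)
  then have wn: "w [^] n = r [^] n \<otimes> y [^] n \<otimes> v [^] (n choose 2)" for n :: nat
    unfolding w_def using c x center_commute[OF v] by (intro pow_mult_commutator) auto
  then have wp: "w [^] p = v [^] (p choose 2)" using k c by (simp flip: r_def)
  \<comment> \<open>If \<open>w\<close> were central, \<open>y\<close> would be a central element
    times a power of \<open>x\<close> and commute with \<open>x\<close>.\<close>
  have w: "w \<notin> center"
  proof
    assume wZ: "w \<in> center"
    have "y = inv r \<otimes> w" using c x by (simp add: w_def flip: m_assoc)
    moreover have "x \<otimes> inv r = inv r \<otimes> x"
    proof -
      have "x \<otimes> r = r \<otimes> x" using x group_commutes_pow by (simp add: r_def)
      then have "r \<in> centralizer G (generate G {x})" using c x by (simp add: mem_centralizer_generate_singleton_iff)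
      then have "inv r \<in> centralizer G (generate G {x})"
        using x subgroup_centralizer generate_incl subgroup.m_inv_closed by (metis empty_subsetI insert_subset)
      then show ?thesis using x by (simp add: mem_centralizer_generate_singleton_iff)
    qed
    ultimately have "x \<otimes> y = y \<otimes> x"
      using c x center_commute[OF wZ x(1)] by (metis inv_closed m_assoc)
    then show False using xy by simp
  qed
  \<comment> \<open>An odd \<open>p\<close> divides \<open>p choose 2\<close>, so
    \<open>v [^] p = \<one>\<close> would make \<open>w [^] p\<close> trivial and \<open>w\<close>
    central.\<close>
  show "p = 2"
  proof (rule ccontr)
    assume "p \<noteq> 2"
    then have "p > 2" using p(1) by (simp add: prime_ge_2_nat le_neq_implies_less)
    then have "odd p" using p(1) by (intro prime_odd_nat)
    then obtain m where "p = 2 * m + 1" by (auto elim: oddE)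
    then have "p choose 2 = p * m" by (simp add: choose_two)
    then have "p dvd (p choose 2)" by simp
    then have "w [^] p = \<one>" using vp wp c by (metis dvdE nat_pow_one nat_pow_pow)
    then show False using w c p(1) pow_prime_eq_one_imp_center by blast
  qed
  \<comment> \<open>Now the order of \<open>w\<close> divides 4, and |Z| divides it properly. So |Z|
    is below 4; being even and positive, it is 2.\<close>
  then have "w [^] (4::nat) = (w [^] p) [^] p" using c by (simp add: nat_pow_pow)
  also have "\<dots> = \<one>" using vp wp c \<open>p = 2\<close> by simp
  finally have "ord w dvd 4" using c pow_eq_id by blast
  moreover have "card center dvd ord w" using card_center_dvd_ord w c by blast
  moreover have "card center \<noteq> ord w"
  proof
    assume "card center = ord w"
    then have "center = generate G {w}"
      using w c by (intro subgroup_eqI_card center_subset_generate)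
        (auto simp: subgroup_generate_singleton simp flip: generate_pow_card)
    then show False using w mem_generate_singleton by blast
  qed
  ultimately have "card center < 4" "card center > 0"
    using card_subgroup_pos[OF subgroup_center]
    by (metis dvd_imp_le dvd_trans le_neq_implies_less zero_less_numeral dvd_antisym, simp)
  moreover have "even (card center)" using p \<open>p = 2\<close> by simp
  ultimately show "card center = 2" by presburger
qed

end

section \<open>The quaternion subgroup when the center has order 2\<close>

lemma non_center_power_exists:
  assumes "w \<in> carrier G" "w \<notin> center"
  shows "\<exists>j::nat. good 2 (w [^] j)"
proof -
  obtain p :: nat where p: "Factorial_Ring.prime p" "p dvd card center"
    using card_center_neq_1 prime_factor_nat by blast
  then show ?thesis using good_power_exists[OF p assms] prime_eq_2_and_card_center_eq_2(1) by blast
qed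

lemma card_center: "card center = 2"
proof -
  obtain p :: nat where "Factorial_Ring.prime p" "p dvd card center"
    using card_center_neq_1 prime_factor_nat by blast
  then show ?thesis by (rule prime_eq_2_and_card_center_eq_2(2))
qed

lemma prime_two: "Factorial_Ring.prime (2::nat)" "2 dvd card center"
  by (simp_all add: card_center)

lemma center_eqI: "s \<in> center \<Longrightarrow> t \<in> center \<Longrightarrow> s \<noteq> \<one> \<Longrightarrow> t \<noteq> \<one> \<Longrightarrow> s = t"
  using card_center subgroup.one_closed[OF subgroup_center] unfolding card_2_iff' by metis

lemma center_square:
  assumes "s \<in> center" shows "s \<otimes> s = \<one>"
proof -
  have "s \<in> carrier G" using assms by (rule center_closed)
  moreover have "ord s dvd 2" using ord_dvd_card_subgroup[OF subgroup_center assms] by (simp add: card_center)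
  ultimately have "s [^] (2::nat) = \<one>" using pow_eq_id by blast
  then show ?thesis using \<open>s \<in> carrier G\<close> by (simp add: numeral_2_eq_2)
qed

lemma good_square:
  assumes "good 2 x" shows "x \<in> carrier G" "x \<notin> center" "x \<otimes> x \<in> center" "x \<otimes> x \<noteq> \<one>"
proof -
  show x: "x \<in> carrier G" "x \<notin> center" "x \<otimes> x \<in> center"
    using assms by (auto simp: good_def numeral_2_eq_2)
  then show "x \<otimes> x \<noteq> \<one>"
    using pow_prime_eq_one_imp_center[OF prime_two(1) x(1)] by (auto simp: numeral_2_eq_2)
qed

lemma good_squareI:
  assumes "x \<in> carrier G" "x \<otimes> x \<in> center" "x \<otimes> x \<noteq> \<one>" shows "good 2 x"
  using assms center_square by (auto simp: good_def numeral_2_eq_2)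

text \<open>The relations of \<open>Q8\<close> without inverses. That \<open>x\<close> has fourth
  power 1 is implied, as \<open>x \<otimes> x\<close> lies in the center of order 2.\<close>

definition quaternion_pair :: "'a \<Rightarrow> 'a \<Rightarrow> bool" where
  "quaternion_pair x y \<longleftrightarrow> good 2 x \<and> good 2 y \<and> y \<otimes> y = x \<otimes> x \<and> y \<otimes> x = x \<otimes> y \<otimes> (x \<otimes> x)"

text \<open>The commutator and the two squares are nontrivial central elements, and there is only
  one such element.\<close>

lemma quaternion_pair_exists: obtains x y where "quaternion_pair x y"
proof -
  obtain x y where xy: "good 2 x" "good 2 y" "x \<otimes> y \<noteq> y \<otimes> x" "conjugate y x \<in> generate G {x}"
    using good_normalizing_exist[OF prime_two] .
  obtain u where u: "u \<in> center" "u \<noteq> \<one>" "y \<otimes> x = x \<otimes> y \<otimes> u"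
    using good_commutator[OF prime_two xy] by metis
  have "u = x \<otimes> x" "y \<otimes> y = x \<otimes> x" using u good_square xy center_eqI by metis+
  then show thesis using that xy u by (simp add: quaternion_pair_def)
qed

lemma quaternion_pairD:
  assumes "quaternion_pair x y"
  shows "x \<in> carrier G" "y \<in> carrier G" "good 2 x" "good 2 y" "y \<otimes> y = x \<otimes> x" "y \<otimes> x = x \<otimes> y \<otimes> (x \<otimes> x)"
    "x \<otimes> y \<noteq> y \<otimes> x"
proof -
  show x: "x \<in> carrier G" "y \<in> carrier G" "good 2 x" "good 2 y" "y \<otimes> y = x \<otimes> x"
    "y \<otimes> x = x \<otimes> y \<otimes> (x \<otimes> x)"
    using assms by (auto simp: quaternion_pair_def good_square)
  show "x \<otimes> y \<noteq> y \<otimes> x"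
  proof
    assume "x \<otimes> y = y \<otimes> x"
    then have "x \<otimes> y \<otimes> (x \<otimes> x) = x \<otimes> y" using x(6) by simp
    then show False using x(1,2) good_square(4)[OF x(3)] by simp
  qed
qed

text \<open>Brings in the third cyclic subgroup of order 4, so that a pair avoiding \<open>K\<close>
  can be chosen.\<close>

lemma quaternion_pair_mult:
  assumes "quaternion_pair x y"
  shows "quaternion_pair (x \<otimes> y) y" "quaternion_pair x (x \<otimes> y)"
proof -
  note d = quaternion_pairD[OF assms]
  note x = d(1,2) and z = good_square(3,4)[OF d(3)]
  have zc: "x \<otimes> x \<otimes> g = g \<otimes> (x \<otimes> x)" if "g \<in> carrier G" for g using z(1) that by (rule center_commute)
  have zz: "x \<otimes> x \<otimes> (x \<otimes> x) = \<one>" using z(1) by (rule center_square)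
  have "x \<otimes> y \<otimes> (x \<otimes> y) = x \<otimes> (y \<otimes> x) \<otimes> y" using x by (simp add: m_assoc)
  also have "\<dots> = x \<otimes> x \<otimes> (y \<otimes> ((x \<otimes> x) \<otimes> y))" using x by (simp add: d(6) m_assoc)
  also have "\<dots> = x \<otimes> x \<otimes> (y \<otimes> (y \<otimes> (x \<otimes> x)))" using x by (simp only: zc)
  also have "\<dots> = x \<otimes> x \<otimes> ((x \<otimes> x) \<otimes> (x \<otimes> x))" using x d(5) by (simp flip: m_assoc)
  also have "\<dots> = x \<otimes> x" using x zz by simp
  finally have sq: "x \<otimes> y \<otimes> (x \<otimes> y) = x \<otimes> x" .
  have g: "good 2 (x \<otimes> y)" using x z sq by (intro good_squareI) auto
  have "y \<otimes> (x \<otimes> y) = x \<otimes> y \<otimes> ((x \<otimes> x) \<otimes> y)" using x d(6) by (simp flip: m_assoc)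
  also have "\<dots> = x \<otimes> y \<otimes> y \<otimes> (x \<otimes> x)" using x by (simp add: zc) (simp add: m_assoc)
  finally show "quaternion_pair (x \<otimes> y) y" using g d sq by (simp add: quaternion_pair_def)
  have "x \<otimes> y \<otimes> x = x \<otimes> (x \<otimes> y) \<otimes> (x \<otimes> x)" using x by (simp add: d(6) m_assoc)
  then show "quaternion_pair x (x \<otimes> y)" using g d sq by (simp add: quaternion_pair_def)
qed

lemma quaternion_pair_generate_neq:
  assumes "quaternion_pair x y" shows "generate G {x} \<noteq> generate G {y}"
  using quaternion_pairD[OF assms] by (intro good_generate_neq[OF prime_two])

text \<open>The subgroups generated by \<open>x\<close>, \<open>y\<close> and
  \<open>x \<otimes> y\<close> are pairwise different, so at most one of them is \<open>K\<close>;
  the other two belong to one of the three pairs.\<close>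

lemma quaternion_pair_in_CD_lattice:
  obtains x y where "quaternion_pair x y" "generate G {x} \<in> CD_lattice G" "generate G {y} \<in> CD_lattice G"
proof -
  obtain x y where xy: "quaternion_pair x y" by (rule quaternion_pair_exists)
  note xy' = quaternion_pair_mult[OF xy]
  note neq = quaternion_pair_generate_neq
  have gen: "generate G {s} \<in> CD_lattice G" "generate G {t} \<in> CD_lattice G"
    if "quaternion_pair s t" "generate G {s} \<noteq> K" "generate G {t} \<noteq> K" for s t
    using that(2,3) good_facts(1,4)[OF prime_two quaternion_pairD(3)[OF that(1)]]
      good_facts(1,4)[OF prime_two quaternion_pairD(4)[OF that(1)]] by (simp_all add: CD)
  show thesis
    using that[OF xy gen[OF xy]] that[OF xy'(1) gen[OF xy'(1)]] that[OF xy'(2) gen[OF xy'(2)]]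
      neq[OF xy] neq[OF xy'(1)] neq[OF xy'(2)] by metis
qed

theorem quaternion_generators:
  obtains x y where "quaternion_pair x y" "carrier G = generate G {x} <#> generate G {y}" "card (carrier G) = 8"
proof -
  obtain x y where xy: "quaternion_pair x y"
    and CD: "generate G {x} \<in> CD_lattice G" "generate G {y} \<in> CD_lattice G"
    by (rule quaternion_pair_in_CD_lattice)
  note d = quaternion_pairD[OF xy]
  define H where "H = generate G {x} <#> generate G {y}"
  have H: "H \<in> CD_lattice G" "subgroup H G" using CD by (simp_all add: H_def CD_lattice_set_mult)
  have cH: "card H = 8"
    unfolding H_def using card_set_mult_generate[OF prime_two] good_facts[OF prime_two] d(3,4)
      quaternion_pair_generate_neq[OF xy] by (simp add: card_center)
  have sub: "generate G {x} \<subseteq> H" "generate G {y} \<subseteq> H"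
    unfolding H_def using d(1,2) by (simp_all add: subset_set_mult subgroup_generate_singleton)
  have mem: "x \<in> H" "y \<in> H" using sub mem_generate_singleton by blast+
  \<comment> \<open>A non-central \<open>w\<close> centralizing \<open>H\<close> has a good power
    commuting with \<open>x\<close>, so \<open>x\<close> is a power of that power. As it commutes
    with \<open>y\<close> as well, so would \<open>x\<close>.\<close>
  have "centralizer G H \<subseteq> center"
  proof (rule ccontr)
    assume "\<not> centralizer G H \<subseteq> center"
    then obtain w where w: "w \<in> centralizer G H" "w \<notin> center" by blast
    then have wc: "w \<in> carrier G" by (simp add: centralizer_def)
    obtain j :: nat where j: "good 2 (w [^] j)" using non_center_power_exists wc w(2) by blast
    have comm: "w [^] j \<otimes> x = x \<otimes> w [^] j" "w [^] j \<otimes> y = y \<otimes> w [^] j"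
      using w mem d(1,2) wc by (auto simp: centralizer_def group_commutes_pow)
    have "x \<in> generate G {w [^] j}" by (rule good_commute_imp_mem[OF prime_two j d(3) comm(1)])
    then obtain i :: nat where "x = (w [^] j) [^] i" using generate_singleton wc by auto
    then have "x \<otimes> y = y \<otimes> x" using comm(2) wc d(2) by (simp add: group_commutes_pow)
    then show False using d(7) by simp
  qed
  moreover have "center \<subseteq> centralizer G H" using H by (simp add: center_subset_centralizer subgroup.subset)
  ultimately have "centralizer G H = center" by (rule equalityI)
  \<comment> \<open>\<open>H\<close> and G are both in CD(G) and have the same centralizer, so equal
    measures give equal orders.\<close>
  then have "card H * card center = card (carrier G) * card center"
    using CD_measure_CD_lattice[OF H(1)] CD_measure_CD_lattice[OF carrier_CD] by simp
  then have "card (carrier G) = 8" using cH by (simp add: card_center)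
  moreover from this have "H = carrier G"
    using H cH by (intro subgroup_eqI_card subgroup_self subgroup.subset) auto
  ultimately show thesis using that xy by (simp add: H_def)
qed

end


section \<open>The quaternion group\<close>

primrec (in group) letter_value :: "('g \<Rightarrow> 'a) \<Rightarrow> 'g letter \<Rightarrow> 'a" where
  "letter_value f (Gen x) = f x"
| "letter_value f (Gen_inv x) = inv (f x)"

definition (in group) word_value :: "('g \<Rightarrow> 'a) \<Rightarrow> 'g letter list \<Rightarrow> 'a" where
  "word_value f w = foldr (\<lambda>l v. letter_value f l \<otimes> v) w \<one>"

lemma (in group) word_value_simps [simp]:
  "word_value f [] = \<one>"
  "word_value f (l # w) = letter_value f l \<otimes> word_value f w"
  by (simp_all add: word_value_def)

text \<open>Evaluation of words respects every rule generating \<open>pres_eq\<close>, so it is well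
  defined on classes.\<close>

lemma (in group) von_Dyck:
  assumes f: "\<And>x. f x \<in> carrier G" and rel: "\<And>u v. (u, v) \<in> R \<Longrightarrow> word_value f u = word_value f v"
  obtains h where "h \<in> hom (presented_group R) G" "\<And>w. h (pres_rel R `` {w}) = word_value f w"
proof -
  have letter: "letter_value f l \<in> carrier G" for l using f by (cases l) auto
  have closed: "word_value f w \<in> carrier G" for w using letter by (induction w) auto
  have append: "word_value f (u @ v) = word_value f u \<otimes> word_value f v" for u v
    using letter closed by (induction u) (auto simp: m_assoc)
  have cong: "word_value f u = word_value f v" if "pres_eq R u v" for u v
    using that by (induction rule: pres_eq.induct) (use f in \<open>auto simp: append rel\<close>)
  define h where "h c = word_value f (SOME w. c = pres_rel R `` {w})" for c
  have h: "h (pres_rel R `` {w}) = word_value f w" for w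
  proof -
    have "pres_rel R `` {w} = pres_rel R `` {SOME w'. pres_rel R `` {w} = pres_rel R `` {w'}}"
      by (rule someI[where P = "\<lambda>w'. pres_rel R `` {w} = pres_rel R `` {w'}"]) (rule HOL.refl)
    then have "pres_eq R w (SOME w'. pres_rel R `` {w} = pres_rel R `` {w'})" unfolding pres_class_eq_iff .
    then show ?thesis unfolding h_def by (rule cong[symmetric])
  qed
  have "h \<in> hom (presented_group R) G"
    by (rule homI) (auto simp: carrier_presented_group h closed mult_presented_group append)
  then show thesis using that h by blast
qed

section \<open>Recognizing the quaternion group\<close>

context finite_group begin

lemma subgroup_eq_carrierI: "subgroup H G \<Longrightarrow> card H = card (carrier G) \<Longrightarrow> H = carrier G"
  by (intro subgroup_eqI_card subgroup_self subgroup.subset) auto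

lemma subgroup_eq_trivI: "subgroup H G \<Longrightarrow> card H = 1 \<Longrightarrow> H = {\<one>}"
  using subgroup.one_closed by (metis card_1_singletonE singletonD)

text \<open>The relations yield a homomorphism from \<open>Q8\<close>. It is onto because every
  element is a power of \<open>x\<close> times a power of \<open>y\<close>, and both groups have
  order 8.\<close>

lemma iso_Q8I:
  assumes x: "x \<in> carrier G" "y \<in> carrier G"
    and rel: "y \<otimes> y = x \<otimes> x" "x \<otimes> x \<otimes> (x \<otimes> x) = \<one>" "y \<otimes> x = x \<otimes> y \<otimes> (x \<otimes> x)"
    and gen: "carrier G = generate G {x} <#> generate G {y}" and card: "card (carrier G) = 8"
  shows "G \<cong> Q8"
proof -
  define f where "f = case_Q8_gen x y"
  have f: "f Q8_gen.a = x" "f Q8_gen.b = y" by (simp_all add: f_def)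
  have fc: "f g \<in> carrier G" for g using x f by (cases g) auto
  \<comment> \<open>The inverse-free commutation rule is turned into the third defining relation of
    \<open>Q8\<close>.\<close>
  have "inv y \<otimes> (x \<otimes> y) = inv x"
  proof -
    have "y \<otimes> inv x = y \<otimes> (x \<otimes> (x \<otimes> x))"
      using rel(2) x by (metis inv_equality m_assoc m_closed)
    also have "\<dots> = (y \<otimes> x) \<otimes> (x \<otimes> x)" using x by (simp add: m_assoc)
    also have "\<dots> = x \<otimes> y \<otimes> (x \<otimes> x \<otimes> (x \<otimes> x))" using x by (simp add: rel(3) m_assoc)
    also have "\<dots> = x \<otimes> y" using x by (simp add: rel(2))
    finally show ?thesis using x by (metis inv_closed inv_solve_left' m_closed)
  qed
  then have "word_value f u = word_value f v" if "(u, v) \<in> Q8_relations" for u v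
    using that x rel f by (auto simp: Q8_relations_def m_assoc)
  then obtain h where h: "h \<in> hom Q8 G" "\<And>w. h (pres_rel Q8_relations `` {w}) = word_value f w"
    using von_Dyck[of f Q8_relations] fc unfolding Q8_def by metis
  have "carrier G \<subseteq> h ` carrier Q8"
  proof
    fix g assume "g \<in> carrier G"
    then obtain i j :: nat where g: "g = x [^] i \<otimes> y [^] j"
      unfolding gen using x generate_singleton by (auto simp: set_mult_def)
    have powy: "word_value f (replicate j (Gen Q8_gen.b)) = y [^] j" for j
    proof (induction j)
      case (Suc j)
      then show ?case using nat_pow_Suc2[OF x(2)] by (simp add: f)
    qed simp
    have "word_value f (replicate i (Gen Q8_gen.a) @ replicate j (Gen Q8_gen.b)) = g"
      unfolding g
    proof (induction i)
      case (Suc i)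
      have "x [^] Suc i \<otimes> y [^] j = x \<otimes> (x [^] i \<otimes> y [^] j)"
        using x nat_pow_Suc2[OF x(1), of i] by (simp add: m_assoc)
      then show ?case using Suc by (simp add: f)
    qed (use x in \<open>simp add: powy\<close>)
    then have "g = h (pres_rel Q8_relations `` {replicate i (Gen Q8_gen.a) @ replicate j (Gen Q8_gen.b)})"
      by (simp add: h(2))
    then show "g \<in> h ` carrier Q8" by (auto simp: Q8_def carrier_presented_group)
  qed
  then have img: "h ` carrier Q8 = carrier G" using h(1) hom_carrier by blast
  have "card (carrier Q8) = 8" using order_Q8 by (simp add: order_def)
  then have "inj_on h (carrier Q8)" using img card by (intro eq_card_imp_inj_on card_ge_0_finite) simp_all
  then have "h \<in> iso Q8 G" using h(1) img by (simp add: isoI bij_betw_def)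
  then have "Q8 \<cong> G" by (rule is_isoI)
  then show ?thesis by (rule group.iso_sym[OF group_Q8])
qed

text \<open>Verifies the hypotheses of \<open>CD_lattice_almost_all\<close>, whose quaternion pair
  then satisfies \<open>iso_Q8I\<close>.\<close>

theorem non_abelian_imp_iso_Q8:
  assumes miss: "card (subgroup_lattice G - CD_lattice G) \<le> 2" and non_abelian: "center \<noteq> carrier G"
  shows "G \<cong> Q8"
proof -
  let ?M = "subgroup_lattice G - CD_lattice G"
  have fM: "finite ?M" using finite_subgroup_lattice by simp
  have nontriv: "carrier G \<noteq> {\<one>}"
    using non_abelian subgroup.one_closed[OF subgroup_center] centralizer_subset[of "carrier G"] by auto
  then have Z: "center \<noteq> {\<one>}" by (intro center_nontrivial miss)
  have center_sub: "center \<subseteq> H" if "H \<in> CD_lattice G" for H using that by (rule center_subset_CD_lattice)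
  have "{\<one>} \<notin> CD_lattice G" using center_sub Z subgroup.one_closed[OF subgroup_center] by blast
  then have triv: "{\<one>} \<in> ?M" using triv_subgroup by (simp add: subgroup_lattice_def)
  \<comment> \<open>\<open>K\<close> is the second missing subgroup, or again the trivial one if
    nothing else is missing.\<close>
  have "\<exists>K\<in>?M. ?M \<subseteq> {{\<one>}, K}"
  proof (rule ccontr)
    assume no: "\<not> (\<exists>K\<in>?M. ?M \<subseteq> {{\<one>}, K})"
    then obtain A where A: "A \<in> ?M" "A \<noteq> {\<one>}" using triv by blast
    then obtain B where B: "B \<in> ?M" "B \<noteq> {\<one>}" "B \<noteq> A" using no by blast
    have "card {{\<one>}, A, B} \<le> card ?M" using A B triv fM by (intro card_mono) auto
    then show False using A B miss by (simp split: if_splits)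
  qed
  then obtain K where K: "K \<in> ?M" "?M \<subseteq> {{\<one>}, K}" by blast
  have sK: "subgroup K G" "K \<notin> CD_lattice G" using K by (auto simp: subgroup_lattice_def)
  have CD: "H \<in> CD_lattice G" if "subgroup H G" "H \<noteq> {\<one>}" "H \<noteq> K" for H
    using that K by (auto simp: subgroup_lattice_def)
  \<comment> \<open>Conjugates of a missing subgroup are missing, so a conjugate of \<open>K\<close>
    is 1 or \<open>K\<close>, and it is 1 only if \<open>K\<close> is.\<close>
  have K_normal: "conjugate g ` K = K" if g: "g \<in> carrier G" for g
  proof -
    have Kc: "K \<subseteq> carrier G" using sK by (simp add: subgroup.subset)
    have cancel: "conjugate (inv g) ` conjugate g ` K = K"
      using g Kc by (force simp: image_image)
    have "conjugate g ` K \<notin> CD_lattice G"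
    proof
      assume "conjugate g ` K \<in> CD_lattice G"
      from CD_lattice_conjugate[OF inv_closed[OF g] this] show False using sK by (simp add: cancel)
    qed
    then have "conjugate g ` K = {\<one>} \<or> conjugate g ` K = K"
      using CD[of "conjugate g ` K"] subgroup_conjugate[OF g sK(1)] by blast
    moreover have "K = {\<one>}" if one: "conjugate g ` K = {\<one>}"
    proof -
      have "k = \<one>" if "k \<in> K" for k
      proof -
        have "conjugate g k \<in> {\<one>}" unfolding one[symmetric] using that by (rule imageI)
        then show ?thesis using that Kc g conjugate_eq_one_iff by blast
      qed
      then show ?thesis using sK(1) subgroup.one_closed by blast
    qed
    ultimately show ?thesis by auto
  qed
  \<comment> \<open>If G were missing, it would be \<open>K\<close>. Then the center would be in
    CD(G), and with it the centralizer of the center, which is G.\<close>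
  have carrier_CD: "carrier G \<in> CD_lattice G"
  proof (rule ccontr)
    assume no: "carrier G \<notin> CD_lattice G"
    then have "carrier G = K" using CD[OF subgroup_self] nontriv by blast
    then have "center \<in> CD_lattice G" using Z non_abelian by (intro CD subgroup_center) auto
    then have "centralizer G center \<in> CD_lattice G" by (rule CD_lattice_centralizer)
    then show False using no by (simp add: centralizer_subset_center)
  qed
  \<comment> \<open>Only \<open>K\<close> could violate this, and then it would meet the center
    trivially and be generated by each of its nontrivial elements. Normality bounds |G| by
    \<open>(card K - 1) * card (centralizer G K)\<close>, while maximality for the join of
    \<open>K\<close> and the center gives
    \<open>card K * card (centralizer G K) \<le> card (carrier G)\<close>.\<close>
  have center_cases: "center \<subseteq> H" if H: "subgroup H G" "\<not> H \<subseteq> center" for H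
  proof (rule ccontr)
    assume not: "\<not> center \<subseteq> H"
    have "H \<noteq> {\<one>}" using H subgroup.one_closed[OF subgroup_center] by blast
    then have HK: "H = K" using CD[OF H(1)] center_sub not by blast
    have I: "subgroup (K \<inter> center) G" using sK subgroup_center subgroups_Inter_pair by blast
    have KZ: "K \<inter> center = {\<one>}"
    proof (rule ccontr)
      assume "K \<inter> center \<noteq> {\<one>}"
      then have "K \<inter> center \<in> CD_lattice G \<or> K \<inter> center = K" using CD[OF I] by blast
      then show False using center_sub[of "K \<inter> center"] not H HK by blast
    qed
    obtain k where k: "k \<in> K" "k \<noteq> \<one>" using sK(1) \<open>H \<noteq> {\<one>}\<close> HK nontrivial_subgroupE by metis
    have kc: "k \<in> carrier G" by (rule subgroup.mem_carrier[OF sK(1) k(1)])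
    have "generate G {k} = K"
    proof (rule ccontr)
      assume "generate G {k} \<noteq> K"
      moreover have "generate G {k} \<noteq> {\<one>}" using mem_generate_singleton[of k] k by blast
      ultimately have "generate G {k} \<in> CD_lattice G" using kc by (intro CD subgroup_generate_singleton)
      then show False using center_sub generate_singleton_subset[OF sK(1) k(1)] not HK by blast
    qed
    then have b: "card (carrier G) \<le> (card K - 1) * card (centralizer G K)"
      using card_le_if_orbit_subset(2)[OF sK(1) k] K_normal k(1) by blast
    define J where "J = generate G (K \<union> center)"
    have Kc: "K \<subseteq> carrier G" using sK by (simp add: subgroup.subset)
    have sJ: "subgroup J G" unfolding J_def using Kc centralizer_subset by (intro generate_is_subgroup) auto
    have KJ: "K \<subseteq> J" "center \<subseteq> J" by (auto simp: J_def intro: generate.incl)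
    have "J \<noteq> K" "J \<noteq> {\<one>}" using KJ not HK k by blast+
    then have "J \<in> CD_lattice G" using CD sJ by blast
    then have J: "card J * card (centralizer G J) = card (carrier G) * card center"
      using CD_measure_CD_lattice CD_measure_CD_lattice[OF carrier_CD] by simp
    have "centralizer G J = centralizer G K \<inter> centralizer G center"
      unfolding J_def using Kc centralizer_subset by (simp add: centralizer_generate centralizer_Un)
    also have "\<dots> = centralizer G K" using centralizer_subset by (auto simp: centralizer_subset_center)
    finally have CJ: "centralizer G J = centralizer G K" .
    have "K <#> center \<subseteq> J" using KJ sJ by (auto simp: set_mult_def subgroup.m_closed subset_iff)
    then have "card (K <#> center) \<le> card J" using sJ by (simp add: card_mono finite_subgroup)
    then have "card K * card center \<le> card J"
      using card_set_mult[OF sK(1) subgroup_center] KZ by simp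
    then have "card K * card center * card (centralizer G K) \<le> card (carrier G) * card center"
      using J CJ by (metis mult_le_mono1)
    then have "card center * (card K * card (centralizer G K)) \<le> card center * card (carrier G)"
      by (simp add: ac_simps)
    then have le: "card K * card (centralizer G K) \<le> card (carrier G)"
      using card_subgroup_pos[OF subgroup_center] by simp
    have "card (centralizer G K) > 0" using Kc card_subgroup_pos subgroup_centralizer by blast
    then have "(card K - 1) * card (centralizer G K) < card K * card (centralizer G K)"
      using card_subgroup_pos[OF sK(1)] by simp
    then show False using b le by linarith
  qed
  interpret CD_lattice_almost_all G K
    using K_normal CD carrier_CD center_cases non_abelian Z by unfold_locales auto
  obtain x y where xy: "quaternion_pair x y" "carrier G = generate G {x} <#> generate G {y}" "card (carrier G) = 8"
    by (rule quaternion_generators)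
  note d = quaternion_pairD[OF xy(1)]
  show ?thesis
    using d(1,2,5) _ d(6) xy(2,3) by (rule iso_Q8I) (intro center_square good_square(3) d(3))
qed

text \<open>The hypotheses are properties of \<open>Q8\<close> that isomorphisms preserve. A
  nontrivial subgroup has even order, so it contains an involution and thereby the center; its
  measure turns out to be 16, against 8 for the trivial subgroup.\<close>

lemma quaternion_CD_lattice:
  assumes card: "card (carrier G) = 8" and cZ: "card center = 2"
    and inv: "\<And>w. w \<in> carrier G \<Longrightarrow> w \<otimes> w = \<one> \<Longrightarrow> w \<in> center"
  shows "CD_lattice G = subgroup_lattice G - {{\<one>}}"
proof -
  have pow: "k = 1 \<or> k = 2 \<or> k = 4 \<or> k = 8" if "k dvd (8::nat)" for k
  proof -
    have "k \<le> 8" using that by (rule dvd_imp_le) simp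
    then have "k \<in> {0..8}" by simp
    also have "{0..8} = {0, 1, 2, 3, 4, 5, 6, 7, 8::nat}" by auto
    finally show ?thesis using that by auto
  qed
  have dvd8: "card H dvd 8" if "subgroup H G" for H
    using card_subgroup_dvd[OF that subgroup_self] that by (simp add: card subgroup.subset)
  have center_sub: "center \<subseteq> H" "even (card H)" if H: "subgroup H G" "H \<noteq> {\<one>}" for H
  proof -
    have "card H \<noteq> 1" using subgroup_eq_trivI H by blast
    then show "even (card H)" using pow[OF dvd8[OF H(1)]] by auto
    then obtain t where t: "t \<in> H" "ord t = 2" using prime_ord_exists[OF two_is_prime_nat H(1)] by blast
    have tc: "t \<in> carrier G" by (rule subgroup.mem_carrier[OF H(1) t(1)])
    then have "t \<otimes> t = \<one>" using pow_ord_eq_1[OF tc] t by (simp add: numeral_2_eq_2)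
    then have "t \<in> center" using inv tc by blast
    then have "generate G {t} \<subseteq> center" by (intro generate_singleton_subset subgroup_center)
    then have "generate G {t} = center"
      using t tc cZ by (intro subgroup_eqI_card subgroup_center) (auto simp flip: generate_pow_card)
    then show "center \<subseteq> H" using generate_singleton_subset[OF H(1) t(1)] by simp
  qed
  have m: "CD_measure G H = 16" if H: "subgroup H G" "H \<noteq> {\<one>}" for H
  proof -
    note sub = center_sub[OF H]
    consider "card H = 2" | "card H = 4" | "card H = 8" using pow[OF dvd8[OF H(1)]] sub(2) by auto
    then show ?thesis
    proof cases
      case 1
      then have "center = H" using sub H(1) cZ by (intro subgroup_eqI_card) auto
      then show ?thesis using 1 card by (auto simp: CD_measure_def centralizer_subset_center)
    next
      case 3
      then have "H = carrier G" using H card by (intro subgroup_eqI_card subgroup_self) (auto dest: subgroup.subset)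
      then show ?thesis using 3 cZ by (simp add: CD_measure_def)
    next
      case 2
      \<comment> \<open>A subgroup of order 4 is generated by any of its non-central elements
        \<open>h\<close>. It is abelian, so its centralizer has order at least 4, and order 8 would
        make \<open>h\<close> central.\<close>
      have "center \<noteq> H" using 2 cZ by auto
      then obtain h where h: "h \<in> H" "h \<notin> center" using sub by blast
      have hc: "h \<in> carrier G" by (rule subgroup.mem_carrier[OF H(1) h(1)])
      let ?A = "generate G {h}"
      have sA: "subgroup ?A G" by (rule subgroup_generate_singleton[OF hc])
      have AH: "?A \<subseteq> H" by (rule generate_singleton_subset[OF H(1) h(1)])
      have "?A \<noteq> {\<one>}" using h(2) mem_generate_singleton[of h] subgroup.one_closed[OF subgroup_center] by (metis singletonD)
      then have ZA: "center \<subseteq> ?A" by (intro center_sub sA)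
      moreover have "center \<noteq> ?A" using h(2) mem_generate_singleton[of h] by blast
      ultimately have "card center < card ?A" using finite_subgroup[OF sA] by (intro psubset_card_mono) auto
      moreover have "card ?A \<noteq> 3" using pow[OF dvd8[OF sA]] by auto
      ultimately have "?A = H" using AH H 2 cZ by (intro subgroup_eqI_card) auto
      have CH: "centralizer G H = {g \<in> carrier G. g \<otimes> h = h \<otimes> g}"
        using mem_centralizer_generate_singleton_iff[OF hc] \<open>?A = H\<close> by auto
      have sC: "subgroup (centralizer G H) G" using H by (intro subgroup_centralizer subgroup.subset)
      have "h \<in> centralizer G H" using CH hc by auto
      then have "?A \<subseteq> centralizer G H" by (intro generate_singleton_subset sC)
      then have "4 \<le> card (centralizer G H)" using \<open>?A = H\<close> 2 finite_subgroup[OF sC] card_mono by metis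
      moreover have "card (centralizer G H) \<noteq> 8"
      proof
        assume "card (centralizer G H) = 8"
        then have "centralizer G H = carrier G"
          using card by (intro subgroup_eqI_card subgroup_self centralizer_subset) auto
        then have "h \<in> center" using h hc unfolding CH centralizer_def by force
        then show False using h by simp
      qed
      ultimately have "card (centralizer G H) = 4" using pow[OF dvd8[OF sC]] by auto
      then show ?thesis using 2 by (simp add: CD_measure_def)
    qed
  qed
  have "carrier G \<noteq> {\<one>}" using card by auto
  then have "16 \<le> max_CD_measure G" using m[OF subgroup_self] CD_measure_le_max[OF subgroup_self] by simp
  moreover obtain H where "subgroup H G" "CD_measure G H = max_CD_measure G" using max_CD_measure_attained by blast
  moreover have m1: "CD_measure G {\<one>} = 8" using card by (simp add: CD_measure_triv)
  ultimately have "max_CD_measure G = 16" using m by (metis numeral_le_iff semiring_norm(69) semiring_norm(71) semiring_norm(72) one_eq_numeral_iff)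
  then show ?thesis using m m1 by (auto simp: CD_lattice_def subgroup_lattice_def)
qed

end

section \<open>Computing in the quaternion group with normal forms\<close>

definition Q8_class :: "nat \<times> bool \<Rightarrow> Q8_gen letter list set" where
  "Q8_class s = pres_rel Q8_relations `` {Q8_nf s}"

abbreviation Q8_nfs :: "(nat \<times> bool) set" where
  "Q8_nfs \<equiv> {0..<4} \<times> UNIV"

lemma Q8_class_eq_iff:
  assumes "s \<in> Q8_nfs" "t \<in> Q8_nfs"
  shows "Q8_class s = Q8_class t \<longleftrightarrow> s = t"
proof
  assume "Q8_class s = Q8_class t"
  then have "foldr Q8_act (Q8_nf s) (0, False) = foldr Q8_act (Q8_nf t) (0, False)"
    unfolding Q8_class_def pres_class_eq_iff by (rule Q8_act_cong) simp
  then show "s = t" using assms by (simp only: Q8_act_nf)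
qed simp

text \<open>The letters of the second normal form lead from \<open>(0, False)\<close> to
  \<open>t\<close>, so those of the first only have to act on \<open>t\<close>. Products thus become
  evaluations of \<open>Q8_act\<close>.\<close>

lemma Q8_class_mult:
  assumes "s \<in> Q8_nfs" "t \<in> Q8_nfs"
  shows "Q8_class s \<otimes>\<^bsub>Q8\<^esub> Q8_class t = Q8_class (foldr Q8_act (Q8_nf s) t)"
  using Q8_nf_eq[of "Q8_nf s @ Q8_nf t"] Q8_act_nf[OF assms(2)]
  by (simp add: Q8_def Q8_class_def mult_presented_group pres_class_eq_iff)

lemma carrier_Q8: "carrier Q8 = Q8_class ` Q8_nfs"
proof
  show "carrier Q8 \<subseteq> Q8_class ` Q8_nfs"
  proof
    fix x assume "x \<in> carrier Q8"
    then obtain w where "x = pres_rel Q8_relations `` {w}" by (auto simp: Q8_def carrier_presented_group)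
    then have "x = Q8_class (foldr Q8_act w (0, False))"
      by (simp add: Q8_class_def pres_class_eq_iff Q8_nf_eq)
    moreover have "foldr Q8_act w (0, False) \<in> Q8_nfs" by (rule Q8_act_closed) simp
    ultimately show "x \<in> Q8_class ` Q8_nfs" by (rule image_eqI)
  qed
  show "Q8_class ` Q8_nfs \<subseteq> carrier Q8"
    unfolding Q8_def carrier_presented_group Q8_class_def by (intro image_subsetI rangeI)
qed

lemma Q8_commute_iff:
  assumes "s \<in> Q8_nfs" "t \<in> Q8_nfs"
  shows "Q8_class s \<otimes>\<^bsub>Q8\<^esub> Q8_class t = Q8_class t \<otimes>\<^bsub>Q8\<^esub> Q8_class s \<longleftrightarrow>
    foldr Q8_act (Q8_nf s) t = foldr Q8_act (Q8_nf t) s"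
  using assms Q8_act_closed by (simp only: Q8_class_mult Q8_class_eq_iff)

lemma center_Q8: "centralizer Q8 (carrier Q8) = Q8_class ` {(0, False), (2, False)}"
proof -
  have "(\<forall>t\<in>Q8_nfs. foldr Q8_act (Q8_nf s) t = foldr Q8_act (Q8_nf t) s) \<longleftrightarrow> s \<in> {(0, False), (2, False)}"
    if "s \<in> Q8_nfs" for s
  proof
    assume "\<forall>t\<in>Q8_nfs. foldr Q8_act (Q8_nf s) t = foldr Q8_act (Q8_nf t) s"
    \<comment> \<open>Commuting with the two generators, encoded as \<open>(1, False)\<close> and
      \<open>(0, True)\<close>, already leaves only two states.\<close>
    then have "foldr Q8_act (Q8_nf s) (1, False) = foldr Q8_act (Q8_nf (1, False)) s"
      "foldr Q8_act (Q8_nf s) (0, True) = foldr Q8_act (Q8_nf (0, True)) s" by simp_all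
    then show "s \<in> {(0, False), (2, False)}"
      using that unfolding Q8_states by (elim insertE emptyE) (simp_all add: Q8_nf_simps)
  next
    assume s: "s \<in> {(0, False), (2, False)}"
    show "\<forall>t\<in>Q8_nfs. foldr Q8_act (Q8_nf s) t = foldr Q8_act (Q8_nf t) s"
    proof
      fix t assume "t \<in> Q8_nfs"
      then show "foldr Q8_act (Q8_nf s) t = foldr Q8_act (Q8_nf t) s"
        using s unfolding Q8_states by (elim insertE emptyE) (simp_all add: Q8_nf_simps)
    qed
  qed
  then have *: "(\<forall>t\<in>Q8_nfs. Q8_class s \<otimes>\<^bsub>Q8\<^esub> Q8_class t = Q8_class t \<otimes>\<^bsub>Q8\<^esub> Q8_class s)
      \<longleftrightarrow> s \<in> {(0, False), (2, False)}" if "s \<in> Q8_nfs" for s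
    using that by (simp only: Q8_commute_iff flip: Ball_def cong: ball_cong)
  have "{(0, False), (2, False)} \<subseteq> Q8_nfs" by auto
  show ?thesis
  proof (intro equalityI subsetI)
    fix w assume w: "w \<in> centralizer Q8 (carrier Q8)"
    then obtain s where s: "w = Q8_class s" "s \<in> Q8_nfs" unfolding centralizer_def carrier_Q8 by blast
    then have "\<forall>t\<in>Q8_nfs. Q8_class s \<otimes>\<^bsub>Q8\<^esub> Q8_class t = Q8_class t \<otimes>\<^bsub>Q8\<^esub> Q8_class s"
      using w unfolding centralizer_def carrier_Q8 by blast
    then show "w \<in> Q8_class ` {(0, False), (2, False)}" using * s by blast
  next
    fix w assume "w \<in> Q8_class ` {(0, False), (2, False)}"
    then obtain s where s: "w = Q8_class s" "s \<in> {(0, False), (2, False)}" by blast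
    then have "s \<in> Q8_nfs" using \<open>{(0, False), (2, False)} \<subseteq> Q8_nfs\<close> by blast
    moreover from this have "\<forall>t\<in>Q8_nfs. Q8_class s \<otimes>\<^bsub>Q8\<^esub> Q8_class t = Q8_class t \<otimes>\<^bsub>Q8\<^esub> Q8_class s"
      using * s(2) by blast
    ultimately show "w \<in> centralizer Q8 (carrier Q8)" unfolding centralizer_def carrier_Q8 s(1) by simp
  qed
qed

lemma card_center_Q8: "card (centralizer Q8 (carrier Q8)) = 2"
  using Q8_class_eq_iff[of "(0, False)" "(2, False)"] by (simp add: center_Q8)

lemma Q8_involution:
  assumes "w \<in> carrier Q8" "w \<otimes>\<^bsub>Q8\<^esub> w = \<one>\<^bsub>Q8\<^esub>"
  shows "w \<in> centralizer Q8 (carrier Q8)"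
proof -
  obtain s where s: "w = Q8_class s" "s \<in> Q8_nfs" using assms(1) unfolding carrier_Q8 by (elim imageE)
  have "\<one>\<^bsub>Q8\<^esub> = Q8_class (0, False)"
    by (simp add: Q8_def one_presented_group Q8_class_def Q8_nf_simps)
  then have "Q8_class (foldr Q8_act (Q8_nf s) s) = Q8_class (0, False)"
    using assms(2) s Q8_class_mult by metis
  moreover have "foldr Q8_act (Q8_nf s) s \<in> Q8_nfs" "(0, False) \<in> Q8_nfs" using Q8_act_closed[OF s(2)] by simp_all
  ultimately have "foldr Q8_act (Q8_nf s) s = (0, False)" by (simp only: Q8_class_eq_iff)
  then have "s \<in> {(0, False), (2, False)}"
    using s(2) unfolding Q8_states by (elim insertE emptyE) (simp_all add: Q8_nf_simps)
  then show ?thesis unfolding center_Q8 s(1) by (rule imageI)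
qed

lemma (in group) center_iso:
  assumes "h \<in> iso G H"
  shows "bij_betw h (centralizer G (carrier G)) (centralizer H (carrier H))"
    and "\<And>g. g \<in> carrier G \<Longrightarrow> h g \<in> centralizer H (carrier H) \<Longrightarrow> g \<in> centralizer G (carrier G)"
proof -
  have h: "h \<in> hom G H" "bij_betw h (carrier G) (carrier H)" using assms by (auto simp: iso_def)
  then have inj: "inj_on h (carrier G)" and img: "h ` carrier G = carrier H" by (auto simp: bij_betw_def)
  have iff: "h g \<otimes>\<^bsub>H\<^esub> h k = h k \<otimes>\<^bsub>H\<^esub> h g \<longleftrightarrow> g \<otimes> k = k \<otimes> g"
    if "g \<in> carrier G" "k \<in> carrier G" for g k
    using that inj by (simp add: inj_on_eq_iff flip: hom_mult[OF h(1)])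
  then have *: "h g \<in> centralizer H (carrier H) \<longleftrightarrow> g \<in> centralizer G (carrier G)" if "g \<in> carrier G" for g
    using that img by (auto simp: centralizer_def simp flip: img)
  then show "\<And>g. g \<in> carrier G \<Longrightarrow> h g \<in> centralizer H (carrier H) \<Longrightarrow> g \<in> centralizer G (carrier G)" by blast
  have sub: "centralizer G (carrier G) \<subseteq> carrier G" "centralizer H (carrier H) \<subseteq> carrier H"
    by (auto simp: centralizer_def)
  then have "h ` centralizer G (carrier G) = centralizer H (carrier H)"
    using * img by (auto 0 3 simp: subset_iff image_iff)
  then show "bij_betw h (centralizer G (carrier G)) (centralizer H (carrier H))"
    using inj sub(1) inj_on_subset by (auto simp: bij_betw_def)
qed

lemma (in finite_group) iso_Q8_CD_lattice:
  assumes "G \<cong> Q8"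
  shows "CD_lattice G = subgroup_lattice G - {{\<one>}}"
proof (rule quaternion_CD_lattice)
  obtain h where h: "h \<in> iso G Q8" using assms by (auto simp: is_iso_def)
  have hom: "h \<in> hom G Q8" using h by (simp add: iso_def)
  show "card (carrier G) = 8" using iso_same_card[OF assms] order_Q8 by (simp add: order_def)
  show "card center = 2" using bij_betw_same_card[OF center_iso(1)[OF h]] card_center_Q8 by simp
  fix w assume w: "w \<in> carrier G" "w \<otimes> w = \<one>"
  have "h w \<otimes>\<^bsub>Q8\<^esub> h w = \<one>\<^bsub>Q8\<^esub>"
    using hom_mult[OF hom w(1) w(1)] hom_one[OF hom is_group group_Q8] w(2) by simp
  then show "w \<in> center" using center_iso(2)[OF h w(1)] Q8_involution hom_in_carrier[OF hom w(1)] by blast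
qed


section \<open>Abelian groups\<close>

context finite_group begin

text \<open>Every centralizer is G, so the measure is proportional to the order of the
  subgroup.\<close>

lemma abelian_CD_lattice:
  assumes "center = carrier G" shows "CD_lattice G = {carrier G}"
proof -
  have m: "CD_measure G H = card H * card (carrier G)" if "subgroup H G" for H
    using that by (simp add: CD_measure_def centralizer_subset_center assms subgroup.subset)
  have pos: "card (carrier G) > 0" using card_subgroup_pos subgroup_self by blast
  have max: "max_CD_measure G = card (carrier G) * card (carrier G)"
  proof (rule antisym)
    obtain H where H: "subgroup H G" "CD_measure G H = max_CD_measure G" using max_CD_measure_attained by blast
    then show "max_CD_measure G \<le> card (carrier G) * card (carrier G)"
      using m[OF H(1)] card_mono[OF finite_carrier subgroup.subset[OF H(1)]] by (metis mult_le_mono1)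
    show "card (carrier G) * card (carrier G) \<le> max_CD_measure G"
      using CD_measure_le_max[OF subgroup_self] m[OF subgroup_self] by simp
  qed
  have "H = carrier G" if "H \<in> CD_lattice G" for H
  proof -
    have H: "subgroup H G" using that by (rule CD_lattice_imp_subgroup)
    then have "card H * card (carrier G) = card (carrier G) * card (carrier G)"
      using that max m by (simp add: CD_lattice_def)
    then have "card H = card (carrier G)" using pos by (metis mult_right_cancel neq0_conv)
    then show ?thesis using H by (intro subgroup_eq_carrierI)
  qed
  moreover have "carrier G \<in> CD_lattice G" using max m subgroup_self by (simp add: CD_lattice_def)
  ultimately show ?thesis by blast
qed

section \<open>Cyclic groups as groups of residues\<close>

lemma cyclic_imp_center:
  assumes "g \<in> carrier G" "generate G {g} = carrier G" shows "center = carrier G"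
proof -
  have "g \<in> center" using mem_centralizer_generate_singleton_iff[OF assms(1)] assms by simp
  then have "generate G {g} \<subseteq> center" by (intro generate_singleton_subset subgroup_center)
  then show ?thesis using assms centralizer_subset by blast
qed

lemma iso_integer_mod_groupI:
  assumes g: "g \<in> carrier G" "generate G {g} = carrier G"
  shows "G \<cong> integer_mod_group (card (carrier G))"
proof -
  let ?n = "card (carrier G)"
  have n: "ord g = ?n" "?n > 0" using g generate_pow_card card_subgroup_pos subgroup_self by auto
  let ?h = "\<lambda>k::int. g [^] k"
  have hom: "?h \<in> hom (integer_mod_group ?n) G"
  proof (rule homI)
    fix i j :: int
    \<comment> \<open>Reducing the exponent modulo \<open>?n\<close> changes it by a multiple of the
      order of \<open>g\<close>.\<close>
    have "int (ord g) dvd (i + j) mod int ?n - (i + j)" using n by (simp add: mod_eq_dvd_iff[symmetric])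
    then have "g [^] ((i + j) mod int ?n) = g [^] (i + j)"
      using int_pow_eq[OF g(1), of "i + j" "(i + j) mod int ?n"] by simp
    then show "?h (i \<otimes>\<^bsub>integer_mod_group ?n\<^esub> j) = ?h i \<otimes> ?h j" using g by (simp add: int_pow_mult)
  qed (use g in auto)
  have "inj_on ?h (carrier (integer_mod_group ?n))"
  proof (rule inj_onI)
    fix i j assume "i \<in> carrier (integer_mod_group ?n)" "j \<in> carrier (integer_mod_group ?n)" "?h i = ?h j"
    then have "int ?n dvd j - i" "i \<in> {0..<int ?n}" "j \<in> {0..<int ?n}"
      using g n by (auto simp: int_pow_eq carrier_integer_mod_group split: if_splits)
    then show "i = j" by (metis atLeastLessThan_iff mod_eq_dvd_iff mod_pos_pos_trivial)
  qed
  moreover from this have "card (?h ` carrier (integer_mod_group ?n)) = ?n"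
    using n by (simp add: card_image carrier_integer_mod_group)
  then have "?h ` carrier (integer_mod_group ?n) = carrier G"
    using hom by (intro subgroup_eqI_card subgroup_self hom_carrier) auto
  ultimately have "?h \<in> iso (integer_mod_group ?n) G" using hom by (simp add: isoI bij_betw_def)
  then have "integer_mod_group ?n \<cong> G" by (rule is_isoI)
  then show ?thesis by (rule group.iso_sym[OF group_integer_mod_group])
qed

lemma iso_integer_mod_groupE:
  assumes "G \<cong> integer_mod_group n" "n > 1"
  obtains g where "g \<in> carrier G" "generate G {g} = carrier G" "card (carrier G) = n"
proof -
  let ?Z = "integer_mod_group n"
  \<comment> \<open>Only for \<open>n > 1\<close> is 1 itself one of the residues from 0 to
    \<open>n - 1\<close>; it generates them all.\<close>
  have one: "1 \<in> carrier ?Z" using assms(2) by simp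
  have "carrier ?Z = range (\<lambda>k::int. 1 [^]\<^bsub>?Z\<^esub> k)"
  proof
    show "carrier ?Z \<subseteq> range (\<lambda>k::int. 1 [^]\<^bsub>?Z\<^esub> k)"
    proof
      fix k assume "k \<in> carrier ?Z"
      then have "k = 1 [^]\<^bsub>?Z\<^esub> k"
        using assms(2) by (simp add: int_pow_integer_mod_group carrier_integer_mod_group)
      then show "k \<in> range (\<lambda>k::int. 1 [^]\<^bsub>?Z\<^esub> k)" by blast
    qed
    show "range (\<lambda>k::int. 1 [^]\<^bsub>?Z\<^esub> k) \<subseteq> carrier ?Z"
      using assms(2) by (auto simp: int_pow_integer_mod_group carrier_integer_mod_group)
  qed
  then have "cyclic_group ?Z" using one group.cyclic_group[OF group_integer_mod_group] by blast
  then have "cyclic_group G" using assms isomorphic_group_cyclicity group_integer_mod_group is_group by blast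
  then obtain g where g: "g \<in> carrier G" "carrier G = range (\<lambda>k::int. g [^] k)" using cyclic_group by blast
  then have "generate G {g} = carrier G" using generate_pow[OF g(1)] by auto
  moreover have "card (carrier G) = n"
    using iso_same_card[OF assms(1)] assms(2) by (simp add: carrier_integer_mod_group)
  ultimately show thesis using that g by blast
qed

text \<open>An element of prime order generates a nontrivial subgroup, and only G is
  available.\<close>

lemma two_subgroups:
  assumes "card (subgroup_lattice G) = 2"
  obtains p :: nat where "Factorial_Ring.prime p" "G \<cong> integer_mod_group p"
proof -
  have nontriv: "carrier G \<noteq> {\<one>}"
  proof
    assume "carrier G = {\<one>}"
    then have "subgroup_lattice G \<subseteq> {{\<one>}}"
      by (auto simp: subgroup_lattice_def dest: subgroup.subset subgroup.one_closed)
    then show False using assms card_mono[of "{{\<one>}}" "subgroup_lattice G"] by simp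
  qed
  have L: "subgroup_lattice G = {{\<one>}, carrier G}"
    using assms nontriv triv_subgroup subgroup_self finite_subgroup_lattice
    by (intro card_seteq[symmetric]) (auto simp: subgroup_lattice_def)
  have "card (carrier G) \<noteq> 1" using nontriv by (metis card_1_singletonE one_closed singletonD)
  then obtain p where p: "Factorial_Ring.prime p" "p dvd card (carrier G)" by (metis prime_factor_nat)
  obtain x where x: "x \<in> carrier G" "ord x = p" using prime_ord_exists[OF p(1) subgroup_self p(2)] .
  have "generate G {x} \<in> subgroup_lattice G" using x by (simp add: subgroup_lattice_def subgroup_generate_singleton)
  moreover have "generate G {x} \<noteq> {\<one>}" using x p(1) generate_pow_card[OF x(1)] by auto
  ultimately have "generate G {x} = carrier G" using L by blast
  then show thesis using that p(1) x iso_integer_mod_groupI generate_pow_card by metis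
qed

text \<open>An element outside the middle subgroup \<open>K\<close> generates G, so G is cyclic and
  has a subgroup of every order dividing |G|.\<close>

lemma three_subgroups:
  assumes "card (subgroup_lattice G) = 3"
  obtains p :: nat where "Factorial_Ring.prime p" "G \<cong> integer_mod_group (p ^ 2)"
proof -
  have nontriv: "carrier G \<noteq> {\<one>}"
  proof
    assume "carrier G = {\<one>}"
    then have "subgroup_lattice G \<subseteq> {{\<one>}}"
      by (auto simp: subgroup_lattice_def dest: subgroup.subset subgroup.one_closed)
    then show False using assms card_mono[of "{{\<one>}}" "subgroup_lattice G"] by simp
  qed
  have "\<not> subgroup_lattice G \<subseteq> {{\<one>}, carrier G}"
    using assms card_mono[of "{{\<one>}, carrier G}" "subgroup_lattice G"] nontriv by auto
  then obtain K where K: "subgroup K G" "K \<noteq> {\<one>}" "K \<noteq> carrier G" by (auto simp: subgroup_lattice_def)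
  have "{{\<one>}, K, carrier G} \<subseteq> subgroup_lattice G"
    using triv_subgroup subgroup_self K by (simp add: subgroup_lattice_def)
  moreover have "card {{\<one>}, K, carrier G} = 3" using K nontriv by auto
  ultimately have L: "subgroup_lattice G = {{\<one>}, K, carrier G}"
    using assms finite_subgroup_lattice by (metis card_subset_eq)
  have sub: "H = {\<one>} \<or> H = K \<or> H = carrier G" if "subgroup H G" for H
  proof -
    have "H \<in> subgroup_lattice G" using that by (simp add: subgroup_lattice_def)
    then show ?thesis unfolding L by simp
  qed
  obtain g where g: "g \<in> carrier G" "g \<notin> K" using K subgroup.subset by blast
  then have "g \<noteq> \<one>" using K subgroup.one_closed by blast
  then have gen: "generate G {g} = carrier G"
    using sub[OF subgroup_generate_singleton[OF g(1)]] g mem_generate_singleton[of g] by blast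
  define n where "n = card (carrier G)"
  have n: "ord g = n" "n > 0" using gen generate_pow_card g card_subgroup_pos subgroup_self by (auto simp: n_def)
  have ord_div: "ord (g [^] d) = n div d" "subgroup (generate G {g [^] d}) G"
    "card (generate G {g [^] d}) = n div d" if "d dvd n" for d
    using that g n by (auto simp: ord_pow dvd_pos_nat subgroup_generate_singleton simp flip: generate_pow_card)
  have "n \<noteq> 1" using nontriv unfolding n_def by (metis card_1_singletonE one_closed singletonD)
  then obtain p where p: "Factorial_Ring.prime p" "p dvd n" by (metis prime_factor_nat)
  \<comment> \<open>\<open>K\<close> is the only candidate for a subgroup of order \<open>d\<close>,
    so all divisors of \<open>n\<close> other than 1 and \<open>n\<close> agree. For
    \<open>p\<close> and its cofactor this means \<open>n = p ^ 2\<close>.\<close>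
  have cardK: "card K = d" if d: "d dvd n" "d \<noteq> 1" "d \<noteq> n" for d
  proof -
    obtain e where e: "n = d * e" using d(1) by (auto elim: dvdE)
    then have "n div e = d" using n by auto
    then have c: "card (generate G {g [^] e}) = d" "subgroup (generate G {g [^] e}) G" using ord_div[of e] e by simp_all
    then show ?thesis using sub[OF c(2)] d by (auto simp: n_def)
  qed
  have "p \<noteq> n"
  proof
    assume "p = n"
    have "card K dvd n" unfolding n_def using K by (intro card_subgroup_dvd subgroup_self subgroup.subset)
    then have "card K = 1 \<or> card K = n" using p \<open>p = n\<close> by (metis prime_nat_iff)
    then show False
    proof
      assume "card K = 1" then show False using subgroup_eq_trivI[OF K(1)] K by simp
    next
      assume "card K = n" then show False
        using subgroup_eq_carrierI[OF K(1)] K by (simp add: n_def)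
    qed
  qed
  obtain q where q: "n = p * q" using p by (auto elim: dvdE)
  have p1: "p \<noteq> 1" "p > 0" using p(1) by (auto simp: prime_gt_0_nat)
  have "q \<noteq> 1" "q \<noteq> n" using q \<open>p \<noteq> n\<close> p1 n by auto
  then have "card K = q" "card K = p" using cardK[of q] cardK[of p] q p p1 \<open>p \<noteq> n\<close> by auto
  then have "n = p ^ 2" using q by (simp add: power2_eq_square)
  then show thesis using that p(1) iso_integer_mod_groupI[OF g(1) gen] by (simp add: n_def)
qed

lemma prime_card_subgroup_lattice:
  assumes "Factorial_Ring.prime (card (carrier G))" shows "card (subgroup_lattice G) = 2"
proof -
  have "H = {\<one>} \<or> H = carrier G" if H: "subgroup H G" for H
  proof -
    have "card H dvd card (carrier G)" using H by (intro card_subgroup_dvd subgroup_self subgroup.subset)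
    then have "card H = 1 \<or> card H = card (carrier G)" using assms by (metis prime_nat_iff)
    then show ?thesis
    proof
      assume "card H = 1" then show ?thesis using subgroup_eq_trivI[OF H] by simp
    next
      assume "card H = card (carrier G)" then show ?thesis
        using subgroup_eq_carrierI[OF H] by simp
    qed
  qed
  then have "subgroup_lattice G = {{\<one>}, carrier G}"
    using triv_subgroup subgroup_self by (auto simp: subgroup_lattice_def)
  moreover have "carrier G \<noteq> {\<one>}" using assms by auto
  ultimately show ?thesis by auto
qed

lemma prime_square_cyclic_subgroup_lattice:
  assumes p: "Factorial_Ring.prime (p::nat)" and g: "g \<in> carrier G" "generate G {g} = carrier G"
    and card: "card (carrier G) = p ^ 2"
  shows "card (subgroup_lattice G) = 3"
proof -
  have n: "ord g = p * p" using g generate_pow_card card by (simp add: power2_eq_square)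
  have p0: "p > 1" using p by (rule prime_gt_1_nat)
  define P where "P = generate G {g [^] p}"
  have P: "subgroup P G" "card P = p"
    using g n p0 ord_pow[of g p] by (auto simp: P_def subgroup_generate_singleton simp flip: generate_pow_card)
  have "H = {\<one>} \<or> H = P \<or> H = carrier G" if H: "subgroup H G" for H
  proof -
    have "card H dvd p ^ 2" unfolding card[symmetric] using H by (intro card_subgroup_dvd subgroup_self subgroup.subset)
    then obtain i where i: "i \<le> 2" "card H = p ^ i" using divides_primepow_nat[OF p] by blast
    then consider "i = 0" | "i = 1" | "i = 2" by linarith
    then show ?thesis
    proof cases
      case 1
      then have "card H = 1" using i by simp
      then show ?thesis using subgroup_eq_trivI[OF H] by simp
    next
      case 3
      then show ?thesis using i card subgroup_eq_carrierI[OF H] by simp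
    next
      case 2
      \<comment> \<open>An element of \<open>H\<close> is a power of \<open>g\<close> whose order
        divides \<open>p\<close>, so its exponent is a multiple of \<open>p\<close>.\<close>
      have "H \<subseteq> P"
      proof
        fix h assume h: "h \<in> H"
        have hc: "h \<in> carrier G" by (rule subgroup.mem_carrier[OF H h])
        then have "h \<in> range (\<lambda>k::nat. g [^] k)" using g generate_singleton by metis
        then obtain k :: nat where k: "h = g [^] k" by blast
        have "ord h dvd p" using ord_dvd_card_subgroup[OF H h] i 2 by simp
        then have "h [^] p = \<one>" using hc pow_eq_id by blast
        then have "g [^] (k * p) = \<one>" using g k by (simp add: nat_pow_pow)
        then have "p * p dvd k * p" using g n pow_eq_id by metis
        then have "p dvd k" using p0 by simp
        then obtain j where "k = p * j" by (auto elim: dvdE)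
        then have "h = (g [^] p) [^] j" using g k by (simp add: nat_pow_pow)
        then show "h \<in> P" using g by (simp add: P_def generate_singleton)
      qed
      then have "H = P" using P i 2 by (intro subgroup_eqI_card) auto
      then show ?thesis by simp
    qed
  qed
  then have "subgroup_lattice G = {{\<one>}, P, carrier G}"
    using triv_subgroup subgroup_self P by (auto simp: subgroup_lattice_def)
  moreover have "card {\<one>} \<noteq> card P" "card P \<noteq> card (carrier G)" "card {\<one>} \<noteq> card (carrier G)"
    using P card p0 by (auto simp: power2_eq_square)
  then have "{\<one>} \<noteq> P" "P \<noteq> carrier G" "{\<one>} \<noteq> carrier G" by metis+
  ultimately show ?thesis by auto
qed

end


section \<open>The theorem\<close>

theorem theorem1p1:
  fixes G :: "('a, 'b) monoid_scheme"
  assumes "group G" and "finite (carrier G)"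
  shows "(int (card (CD_lattice G)) = int (card (subgroup_lattice G)) - 1 \<longleftrightarrow>
            (\<exists>p::nat. Factorial_Ring.prime p \<and> G \<cong> integer_mod_group p) \<or> G \<cong> Q8)
       \<and> (int (card (CD_lattice G)) = int (card (subgroup_lattice G)) - 2 \<longleftrightarrow>
            (\<exists>p::nat. Factorial_Ring.prime p \<and> G \<cong> integer_mod_group (p ^ 2)))"
proof -
  interpret finite_group G using assms by (simp add: finite_group_def finite_group_axioms_def)
  let ?L = "subgroup_lattice G" and ?D = "CD_lattice G"
  let ?p = "\<exists>p::nat. Factorial_Ring.prime p \<and> G \<cong> integer_mod_group p"
  let ?pp = "\<exists>p::nat. Factorial_Ring.prime p \<and> G \<cong> integer_mod_group (p ^ 2)"
  have sub: "?D \<subseteq> ?L" by (auto simp: CD_lattice_def subgroup_lattice_def)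
  have miss: "card (?L - ?D) = card ?L - card ?D" "card ?D \<le> card ?L"
    using sub finite_subgroup_lattice by (simp_all add: card_Diff_subset finite_subset card_mono)
  have Q8: "card ?L = card ?D + 1" if "G \<cong> Q8"
  proof -
    have "{\<one>\<^bsub>G\<^esub>} \<in> ?L" using triv_subgroup by (simp add: subgroup_lattice_def)
    then show ?thesis using iso_Q8_CD_lattice[OF that] finite_subgroup_lattice
      by (metis Suc_eq_plus1 card.remove)
  qed
  have p: "card ?D = 1" "card ?L = 2" if hyp: "?p"
  proof -
    obtain p :: nat where p: "Factorial_Ring.prime p" "G \<cong> integer_mod_group p" using hyp by blast
    obtain g where g: "g \<in> carrier G" "generate G {g} = carrier G" "card (carrier G) = p"
      using iso_integer_mod_groupE[OF p(2)] p(1) prime_gt_1_nat by blast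
    show "card ?D = 1" using abelian_CD_lattice cyclic_imp_center[OF g(1,2)] by simp
    show "card ?L = 2" using prime_card_subgroup_lattice g(3) p(1) by simp
  qed
  have pp: "card ?D = 1" "card ?L = 3" if hyp: "?pp"
  proof -
    obtain p :: nat where p: "Factorial_Ring.prime p" "G \<cong> integer_mod_group (p ^ 2)" using hyp by blast
    have "p ^ 2 > 1" using prime_gt_1_nat[OF p(1)] by (intro one_less_power) simp_all
    then obtain g where g: "g \<in> carrier G" "generate G {g} = carrier G" "card (carrier G) = p ^ 2"
      using iso_integer_mod_groupE[OF p(2)] by blast
    show "card ?D = 1" using abelian_CD_lattice cyclic_imp_center[OF g(1,2)] by simp
    show "card ?L = 3" by (rule prime_square_cyclic_subgroup_lattice[OF p(1) g])
  qed
  \<comment> \<open>In the abelian case CD(G) has one element, so G has two or three subgroups.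
    These counts decide below which of the two equations holds.\<close>
  have main: "?p \<and> card ?L = 2 \<or> ?pp \<and> card ?L = 3 \<or> G \<cong> Q8"
    if "card ?L = card ?D + 1 \<or> card ?L = card ?D + 2"
  proof (cases "center = carrier G")
    case True
    then have "card ?L = 2 \<or> card ?L = 3" using that abelian_CD_lattice by auto
    then show ?thesis using two_subgroups three_subgroups by metis
  next
    case False
    then show ?thesis using non_abelian_imp_iso_Q8 that miss by auto
  qed
  \<comment> \<open>Subtraction of integers is not truncated, so both equations can be read as sums
    of natural numbers.\<close>
  have iff: "int (card ?D) = int (card ?L) - 1 \<longleftrightarrow> card ?L = card ?D + 1"
    "int (card ?D) = int (card ?L) - 2 \<longleftrightarrow> card ?L = card ?D + 2" by linarith+
  show ?thesis unfolding iff
  proof (intro conjI iffI)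
    assume 1: "card ?L = card ?D + 1"
    then consider "?p" | "?pp" | "G \<cong> Q8" using main by blast
    then show "?p \<or> G \<cong> Q8"
    proof cases
      case 2
      then show ?thesis using 1 pp by simp
    qed simp_all
  next
    assume "?p \<or> G \<cong> Q8"
    then show "card ?L = card ?D + 1" using p Q8 by (elim disjE) simp_all
  next
    assume 2: "card ?L = card ?D + 2"
    then consider "?p" | "?pp" | "G \<cong> Q8" using main by blast
    then show "?pp"
    proof cases
      case 1
      then show ?thesis using 2 p by simp
    next
      case 3
      then show ?thesis using 2 Q8 by simp
    qed simp
  next
    assume "?pp"
    then show "card ?L = card ?D + 2" using pp by simp
  qed
qed

end
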